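(* Let $d\ge 3$ be an integer, let $C>0$ and $0\le s,t\le d$, and assume that $s-d+2>0$. Define $$f(t)=\begin{cases}1/2, & \text{if } t\ge 1,\\[2pt] \dfrac{t}{1+t}, & \text{if } t<1.\end{cases}$$ Then there exists $\delta_0=\delta_0(C,s,t)>0$ (which may also depend on $d$) such that for all constants $C_P,C_\Pi>0$ and every $\epsilon>0$ there is a constant $K>0$, depending only on $d,C,s,t,C_P,C_\Pi,\epsilon$, with the following property. For every $\delta\in(0,\delta_0)$, every $\delta$-separated $(\delta,s,C_P)$-set $P$ of points in $B(0,1)\subset\mathbb{R}^d$, and every $\delta$-separated $(\delta,t,C_\Pi)$-set $\Pi$ of affine hyperplanes of $\mathbb{R}^d$ each intersecting $B(0,1)$, one has $$I_{C\delta}(P,\Pi)\le K\,|P|\cdot|\Pi|\cdot\delta^{f(t)(s-d+2)-\epsilon},$$ where $I_{C\delta}(P,\Pi)=\#\{(p,\pi)\in P\times\Pi\colon p\in\pi(C\delta)\}$.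
   Context: $B(0,1)$ is the unit ball of $\mathbb{R}^d$ centered at the origin, $|\cdot|$ of a finite set denotes cardinality, and $\pi(C\delta)$ denotes the $C\delta$-neighborhood of the hyperplane $\pi$ in $\mathbb{R}^d$. Definition ($(\delta,s,C)$-set). Let $0\le s<\infty$, $\delta\in(0,1)$, $C>0$, and let $(X,d)$ be a metric space. A bounded set $E\subset X$ is called a $(\delta,s,C)$-set if for every $\delta\le r\le 1$ and every ball $B\subset X$ of radius $r$, $$|E\cap B|_\delta\le C r^s|E|_\delta,$$ where $|E|_\delta$ denotes the $\delta$-covering number of $E$ (the minimal number of balls of radius $\delta$ needed to cover $E$). A subset of a metric space is $\delta$-separated if any two distinct elements are at distance at least $\delta$. Points are considered in $\mathbb{R}^d$ with the Euclidean metric. Hyperplanes are considered in the space $\mathcal{A}(d,d-1)$ of affine hyperplanes of $\mathbb{R}^d$ with the metric $$d_{\mathcal{A}}(V,W)=\|\pi_{V_0}-\pi_{W_0}\|_{op}+|a-b|,$$ where $V=V_0+a$, $W=W_0+b$, $V_0,W_0$ are $(d-1)$-dimensional linear subspaces, $a\in V_0^\perp$, $b\in W_0^\perp$, $\pi_{V_0},\pi_{W_0}$ are the orthogonal projections onto $V_0,W_0$, and $\|\cdot\|_{op}$ is the operator norm. *)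

theory Defs
  imports "HOL-Analysis.Analysis"
begin

section \<open>Covering numbers and non-concentrated sets in a metric space\<close>

text \<open>All balls are closed. The covering number is the infimum of a set of cardinalities, hence a
  minimum whenever a finite cover exists, and \<open>\<infinity>\<close> otherwise.\<close>

context Metric_space
begin

definition covering_number :: "real \<Rightarrow> 'a set \<Rightarrow> ennreal" where
  "covering_number \<delta> E =
     (INF A \<in> {A. finite A \<and> A \<subseteq> M \<and> E \<subseteq> (\<Union>x\<in>A. mcball x \<delta>)}. of_nat (card A))"

definition delta_set :: "real \<Rightarrow> real \<Rightarrow> real \<Rightarrow> 'a set \<Rightarrow> bool" where
  "delta_set \<delta> s C E \<longleftrightarrow>
     0 \<le> s \<and> 0 < \<delta> \<and> \<delta> < 1 \<and> 0 < C \<and> mbounded E \<and>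
     (\<forall>r x. \<delta> \<le> r \<and> r \<le> 1 \<and> x \<in> M \<longrightarrow>
        covering_number \<delta> (E \<inter> mcball x r) \<le> ennreal (C * r powr s) * covering_number \<delta> E)"

definition delta_separated :: "real \<Rightarrow> 'a set \<Rightarrow> bool" where
  "delta_separated \<delta> E \<longleftrightarrow> E \<subseteq> M \<and> (\<forall>x\<in>E. \<forall>y\<in>E. x \<noteq> y \<longrightarrow> \<delta> \<le> d x y)"

end

section \<open>The metric space of affine hyperplanes\<close>

definition hyperplanes :: "'a::euclidean_space set set" where
  "hyperplanes = {V. affine V \<and> aff_dim V = int DIM('a) - 1}"

definition orth_proj :: "'a::euclidean_space set \<Rightarrow> 'a \<Rightarrow> 'a" where
  "orth_proj U x = (THE y. y \<in> U \<and> x - y \<in> U\<^sup>\<bottom>)"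

text \<open>If \<open>V = V\<^sub>0 + a\<close> with \<open>V\<^sub>0\<close> a linear subspace and \<open>a\<close> orthogonal to \<open>V\<^sub>0\<close>, then
  \<open>direction V = V\<^sub>0\<close> and \<open>foot V = a\<close> (lemma \<open>direction_foot\<close>).\<close>

definition direction :: "'a::euclidean_space set \<Rightarrow> 'a set" where
  "direction V = {x - y | x y. x \<in> V \<and> y \<in> V}"

definition foot :: "'a::euclidean_space set \<Rightarrow> 'a" where
  "foot V = (THE a. a \<in> V \<and> a \<in> (direction V)\<^sup>\<bottom>)"

text \<open>The value \<open>0\<close> off \<open>hyperplanes\<close> is a dummy: the locale \<open>Metric_space\<close> asks for nonnegativity
  and symmetry on the whole type.\<close>

definition dist_hyp :: "'a::euclidean_space set \<Rightarrow> 'a set \<Rightarrow> real" where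
  "dist_hyp V W =
     (if V \<in> hyperplanes \<and> W \<in> hyperplanes
      then onorm (\<lambda>x. orth_proj (direction V) x - orth_proj (direction W) x) + norm (foot V - foot W)
      else 0)"

lemma orth_proj_eqI:
  assumes U: "subspace U" and y: "y \<in> U" "x - y \<in> U\<^sup>\<bottom>"
  shows "orth_proj U x = y"
  unfolding orth_proj_def
proof (rule the_equality)
  show "y \<in> U \<and> x - y \<in> U\<^sup>\<bottom>" using y by simp
next
  fix z assume z: "z \<in> U \<and> x - z \<in> U\<^sup>\<bottom>"
  have "y - z \<in> U" using U y z by (simp add: subspace_diff)
  moreover have "(x - z) - (x - y) \<in> U\<^sup>\<bottom>"
    using y z subspace_diff[OF subspace_orthogonal_comp] by blast
  ultimately have "(y - z) \<bullet> (y - z) = 0"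
    by (auto simp: orthogonal_comp_def orthogonal_def)
  then show "z = y" by simp
qed

lemma orth_proj:
  assumes U: "subspace U"
  shows "orth_proj U x \<in> U" "x - orth_proj U x \<in> U\<^sup>\<bottom>"
proof -
  obtain y z where yz: "y \<in> span U" "\<And>w. w \<in> span U \<Longrightarrow> orthogonal z w" "x = y + z"
    using orthogonal_subspace_decomp_exists[of U x] by metis
  have "y \<in> U" using yz U by (simp add: span_eq_iff[THEN iffD2])
  moreover have "x - y \<in> U\<^sup>\<bottom>"
    using yz by (auto simp: orthogonal_comp_def orthogonal_commute span_base)
  ultimately show "orth_proj U x \<in> U" "x - orth_proj U x \<in> U\<^sup>\<bottom>"
    using orth_proj_eqI[OF U] by metis+
qed

lemma orth_proj_id: "subspace U \<Longrightarrow> x \<in> U \<Longrightarrow> orth_proj U x = x"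
  by (rule orth_proj_eqI) (auto simp: subspace_orthogonal_comp subspace_0)

lemma linear_orth_proj:
  assumes U: "subspace U"
  shows "linear (orth_proj U)"
proof (rule linearI)
  note P = orth_proj[OF U] and O = subspace_orthogonal_comp[of U]
  fix x y :: 'a and c :: real
  have "x + y - (orth_proj U x + orth_proj U y) \<in> U\<^sup>\<bottom>"
    using subspace_add[OF O P(2)[of x] P(2)[of y]] by (simp add: algebra_simps)
  then show "orth_proj U (x + y) = orth_proj U x + orth_proj U y"
    by (intro orth_proj_eqI[OF U]) (auto intro: subspace_add U P)
  have "c *\<^sub>R x - c *\<^sub>R orth_proj U x \<in> U\<^sup>\<bottom>"
    using subspace_scale[OF O P(2)[of x], of c] by (simp add: algebra_simps)
  then show "orth_proj U (c *\<^sub>R x) = c *\<^sub>R orth_proj U x"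
    by (intro orth_proj_eqI[OF U]) (auto intro: subspace_scale U P)
qed

lemma direction_foot:
  fixes V0 :: "'a::euclidean_space set"
  assumes V0: "subspace V0" and a: "a \<in> V0\<^sup>\<bottom>"
  shows "direction ((+) a ` V0) = V0" "foot ((+) a ` V0) = a"
proof -
  have "x \<in> direction ((+) a ` V0)" if "x \<in> V0" for x
  proof -
    have "x = (a + x) - (a + 0)" by simp
    then show ?thesis unfolding direction_def using that subspace_0[OF V0] by blast
  qed
  then show *: "direction ((+) a ` V0) = V0"
    by (auto simp: direction_def subspace_diff[OF V0])
  show "foot ((+) a ` V0) = a"
    unfolding foot_def *
  proof (rule the_equality)
    show "a \<in> (+) a ` V0 \<and> a \<in> V0\<^sup>\<bottom>"
      using a subspace_0[OF V0] by force
  next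
    fix b assume b: "b \<in> (+) a ` V0 \<and> b \<in> V0\<^sup>\<bottom>"
    then obtain v where v: "v \<in> V0" "b = a + v" by auto
    have "b - a \<in> V0\<^sup>\<bottom>"
      using a b subspace_diff[OF subspace_orthogonal_comp] by blast
    then have "v \<bullet> v = 0" using v by (auto simp: orthogonal_comp_def orthogonal_def)
    then show "b = a" using v by simp
  qed
qed

lemma hyperplanes_iff:
  fixes V :: "'a::euclidean_space set"
  shows "V \<in> hyperplanes \<longleftrightarrow>
    (\<exists>V0 a. subspace V0 \<and> dim V0 = DIM('a) - 1 \<and> a \<in> V0\<^sup>\<bottom> \<and> V = (+) a ` V0)"
proof
  assume V: "V \<in> hyperplanes"
  have "V \<noteq> {}" using V DIM_positive[where 'a='a] by (auto simp: hyperplanes_def)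
  then obtain p where p: "p \<in> V" by auto
  define V0 where "V0 = (\<lambda>x. - p + x) ` V"
  have V0: "subspace V0"
    using V p affine_diffs_subspace unfolding V0_def hyperplanes_def by blast
  have "aff_dim V0 = int DIM('a) - 1"
    using V aff_dim_translation_eq[of "-p" V] by (simp add: V0_def hyperplanes_def)
  then have dim: "dim V0 = DIM('a) - 1"
    using aff_dim_subspace[OF V0] by simp
  define a where "a = p - orth_proj V0 p"
  have "V = (+) p ` V0" by (force simp: V0_def image_image)
  also have "\<dots> = (+) a ` V0"
  proof -
    have "x \<in> (+) a ` V0 \<longleftrightarrow> x - a \<in> V0" "x \<in> (+) p ` V0 \<longleftrightarrow> x - p \<in> V0" for x
      by (auto simp: image_iff algebra_simps intro: bexI[of _ "x - a"] bexI[of _ "x - p"])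
    moreover have "x - a \<in> V0 \<longleftrightarrow> x - p \<in> V0" for x
    proof -
      have q: "orth_proj V0 p \<in> V0" using orth_proj[OF V0] by simp
      have e: "x - a = (x - p) + orth_proj V0 p" "x - p = (x - a) - orth_proj V0 p"
        by (auto simp: a_def)
      show ?thesis using subspace_add[OF V0 _ q] subspace_diff[OF V0 _ q] e by metis
    qed
    ultimately show ?thesis by blast
  qed
  finally show "\<exists>V0 a. subspace V0 \<and> dim V0 = DIM('a) - 1 \<and> a \<in> V0\<^sup>\<bottom> \<and> V = (+) a ` V0"
    using V0 dim orth_proj(2)[OF V0, of p] a_def by blast
next
  assume "\<exists>V0 a. subspace V0 \<and> dim V0 = DIM('a) - 1 \<and> a \<in> V0\<^sup>\<bottom> \<and> V = (+) a ` V0"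
  then show "V \<in> hyperplanes"
    using DIM_positive[where 'a='a]
    by (auto simp: hyperplanes_def affine_translation[symmetric] subspace_imp_affine
        aff_dim_translation_eq aff_dim_subspace of_nat_diff)
qed

lemma dist_hyp_eq:
  fixes V0 W0 :: "'a::euclidean_space set"
  assumes "subspace V0" "dim V0 = DIM('a) - 1" "a \<in> V0\<^sup>\<bottom>"
    and "subspace W0" "dim W0 = DIM('a) - 1" "b \<in> W0\<^sup>\<bottom>"
  shows "dist_hyp ((+) a ` V0) ((+) b ` W0) =
    onorm (\<lambda>x. orth_proj V0 x - orth_proj W0 x) + norm (a - b)"
proof -
  have "(+) a ` V0 \<in> hyperplanes" "(+) b ` W0 \<in> hyperplanes"
    using assms hyperplanes_iff by blast+
  then show ?thesis using assms by (simp add: dist_hyp_def direction_foot)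
qed

lemma hyperplane_decomp:
  assumes "V \<in> hyperplanes"
  shows "subspace (direction V)" "V = (+) (foot V) ` direction V"
  using assms by (auto simp: hyperplanes_iff direction_foot)

interpretation Hyp: Metric_space "hyperplanes :: 'a::euclidean_space set set" dist_hyp
proof
  have bl: "bounded_linear (\<lambda>x. orth_proj (direction V) x - orth_proj (direction W) x)"
    if "V \<in> hyperplanes" "W \<in> hyperplanes" for V W :: "'a set"
    using that hyperplane_decomp linear_orth_proj
    by (intro linear_conv_bounded_linear[THEN iffD1] linear_compose_sub) blast+
  show "0 \<le> dist_hyp V W" for V W :: "'a set"
    using bl[of V W] by (auto simp: dist_hyp_def onorm_pos_le)
  show "dist_hyp V W = dist_hyp W V" for V W :: "'a set"
  proof -
    have "onorm (\<lambda>x. orth_proj (direction V) x - orth_proj (direction W) x)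
        = onorm (\<lambda>x. orth_proj (direction W) x - orth_proj (direction V) x)"
      by (simp add: onorm_def norm_minus_commute)
    then show ?thesis by (simp add: dist_hyp_def norm_minus_commute)
  qed
  show "dist_hyp V W = 0 \<longleftrightarrow> V = W" if VW: "V \<in> hyperplanes" "W \<in> hyperplanes" for V W :: "'a set"
  proof
    assume "dist_hyp V W = 0"
    with onorm_pos_le[OF bl[OF VW]] VW have
      o: "onorm (\<lambda>x. orth_proj (direction V) x - orth_proj (direction W) x) = 0"
      and n: "foot V = foot W"
      by (auto simp: dist_hyp_def add_nonneg_eq_0_iff)
    have e: "orth_proj (direction V) x = orth_proj (direction W) x" for x
      using onorm_eq_0[OF bl[OF VW]] o by simp
    have "direction V = direction W"
      using e orth_proj(1) orth_proj_id hyperplane_decomp(1) VW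
      by (metis subset_antisym subsetI)
    then show "V = W" using n hyperplane_decomp(2) VW by metis
  next
    assume "V = W" then show "dist_hyp V W = 0" by (simp add: dist_hyp_def onorm_zero)
  qed
  show "dist_hyp U W \<le> dist_hyp U V + dist_hyp V W"
    if "U \<in> hyperplanes" "V \<in> hyperplanes" "W \<in> hyperplanes" for U V W :: "'a set"
    using onorm_triangle[OF bl[of U V] bl[of V W]] that norm_triangle_ineq[of "foot U - foot V" "foot V - foot W"]
    by (auto simp: dist_hyp_def)
qed

section \<open>Incidences\<close>

text \<open>The neighbourhood is the closed one: for nonempty \<open>A\<close>, \<open>infdist x A\<close> is the distance from
  \<open>x\<close> to \<open>A\<close>.\<close>

definition neighborhood :: "'a::metric_space set \<Rightarrow> real \<Rightarrow> 'a set" where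
  "neighborhood A r = {x. infdist x A \<le> r}"

definition incidences :: "real \<Rightarrow> 'a::metric_space set \<Rightarrow> 'a set set \<Rightarrow> nat" where
  "incidences r P H = card {(p, \<pi>). p \<in> P \<and> \<pi> \<in> H \<and> p \<in> neighborhood \<pi> r}"

definition incidence_exponent :: "real \<Rightarrow> real" where
  "incidence_exponent t = (if t \<ge> 1 then 1 / 2 else t / (1 + t))"

end

theory Submission
  imports Defs
begin

text \<open>The double count is Cauchy--Schwarz over the points: writing \<open>I\<close> for the number of
  incidences, \<open>I\<^sup>2\<close> is at most \<open>card P\<close> times the sum, over pairs \<open>(\<pi>, \<pi>')\<close> of hyperplanes, of the
  number of points near both. Two hyperplanes at distance \<open>\<rho>\<close> that share a nearby point of the unit
  ball meet at an angle comparable to \<open>\<rho>\<close>, up to \<open>O(\<delta>)\<close>, so their common neighbourhood is covered by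
  \<open>O(\<delta> powr (2 - d) / \<rho>)\<close> balls of radius \<open>\<delta>\<close> and contains \<open>O(\<delta> powr \<sigma> / \<rho>)\<close> times \<open>card P\<close> points,
  where \<open>\<sigma> = s - d + 2\<close>. Pairs with \<open>\<rho> \<le> r\<close> contribute at most a multiple of \<open>r powr t * card H * I\<close> by
  non-concentration; the others are summed dyadically, which costs the logarithm absorbed by
  \<open>\<epsilon>\<close>. Replacing \<open>t\<close> by \<open>min t 1\<close> and optimising in \<open>r\<close> yields the exponent \<open>t \<sigma> / (1 + t)\<close>.\<close>

section \<open>Counting separated sets in balls\<close>

text \<open>Rescaling by \<open>1 / \<delta>\<close> about \<open>z\<close> moves the image into the
  fixed ball of radius \<open>R\<close>, which finitely many balls of radius \<open>1/2\<close>
  cover; none of them can hold two images that are at distance at least 1. So \<open>N\<close>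
  depends on \<open>R\<close> but not on \<open>\<delta>\<close>. The set is counted through a map
  \<open>f\<close> so that hyperplanes can be counted by their coordinates in a Euclidean
  space.\<close>

lemma separated_map_card_bound:
  fixes R :: real
  shows "\<exists>N::nat. \<forall>\<delta> (z::'b::euclidean_space) (S::'a set) f.
    0 < \<delta> \<longrightarrow> f ` S \<subseteq> cball z (R * \<delta>) \<longrightarrow> (\<forall>u\<in>S. \<forall>v\<in>S. u \<noteq> v \<longrightarrow> \<delta> \<le> dist (f u) (f v)) \<longrightarrow>
    finite S \<and> card S \<le> N"
proof -
  have "compact (cball (0::'b) R)" by simp
  then have "\<exists>k. finite k \<and> cball (0::'b) R \<subseteq> (\<Union>x\<in>k. ball x (1/2))"
    unfolding compact_eq_totally_bounded by simp
  then obtain k where k: "finite k" "cball (0::'b) R \<subseteq> (\<Union>x\<in>k. ball x (1/2))" by blast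
  show ?thesis
  proof (intro exI allI impI)
    fix \<delta> :: real and z :: 'b and S :: "'a set" and f :: "'a \<Rightarrow> 'b"
    assume \<delta>: "0 < \<delta>" and S: "f ` S \<subseteq> cball z (R * \<delta>)"
      and sep: "\<forall>u\<in>S. \<forall>v\<in>S. u \<noteq> v \<longrightarrow> \<delta> \<le> dist (f u) (f v)"
    define g where "g u = (1/\<delta>) *\<^sub>R (f u - z)" for u
    have "\<exists>c\<in>k. dist c (g u) < 1/2" if "u \<in> S" for u
    proof -
      have "norm (f u - z) \<le> R * \<delta>" using S that by (auto simp: dist_norm norm_minus_commute)
      then have "g u \<in> cball 0 R" using \<delta> by (simp add: g_def pos_divide_le_eq)
      then have "g u \<in> (\<Union>x\<in>k. ball x (1/2))" using k(2) by blast
      then show ?thesis by auto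
    qed
    then obtain c where c: "\<And>u. u \<in> S \<Longrightarrow> c u \<in> k \<and> dist (c u) (g u) < 1/2" by metis
    have "inj_on c S"
    proof (rule inj_onI, rule ccontr)
      fix u v assume uv: "u \<in> S" "v \<in> S" "c u = c v" "u \<noteq> v"
      have "dist (g u) (g v) \<le> dist (c u) (g u) + dist (c v) (g v)"
        using dist_triangle3[of "g u" "g v" "c u"] uv by simp
      also have "\<dots> < 1" using c[of u] c[of v] uv by linarith
      finally have "dist (g u) (g v) < 1" .
      moreover have "g u - g v = (1/\<delta>) *\<^sub>R (f u - f v)" by (simp add: g_def algebra_simps)
      then have "dist (g u) (g v) = dist (f u) (f v) / \<delta>" using \<delta> by (simp add: dist_norm)
      ultimately have "dist (f u) (f v) < \<delta>" using \<delta> by (simp add: divide_less_eq)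
      moreover have "\<delta> \<le> dist (f u) (f v)" using sep uv(1,2,4) by blast
      ultimately show False by simp
    qed
    moreover have "c ` S \<subseteq> k" using c by auto
    ultimately show "finite S \<and> card S \<le> card k"
      using k(1) inj_on_finite card_inj_on_le by blast
  qed
qed

text \<open>For a finite separated set the covering number is comparable to the cardinality: the
  points themselves are centres of a cover, and each ball of a cover contains at most
  \<open>N\<close> of them. Non-concentration thus passes from covering numbers to cardinalities at
  the cost of the factor \<open>N\<close>.\<close>

lemma (in Metric_space) delta_set_card_le:
  assumes E: "finite E" "delta_separated \<delta> E" "delta_set \<delta> s C E"
    and N: "\<And>x S. x \<in> M \<Longrightarrow> S \<subseteq> mcball x \<delta> \<Longrightarrow> delta_separated \<delta> S \<Longrightarrow> card S \<le> N"
    and r: "\<delta> \<le> r" "r \<le> 1" "x \<in> M"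
  shows "real (card (E \<inter> mcball x r)) \<le> real N * C * r powr s * real (card E)"
proof -
  have \<delta>: "0 < \<delta>" "0 < C" using E by (auto simp: delta_set_def)
  have EM: "E \<subseteq> M" using E by (simp add: delta_separated_def)
  have up: "covering_number \<delta> E \<le> of_nat (card E)"
    unfolding covering_number_def using E EM \<delta>
    by (intro INF_lower) auto
  have low: "of_nat (card (E \<inter> mcball x r)) \<le> of_nat N * covering_number \<delta> (E \<inter> mcball x r)"
  proof (cases "N = 0")
    case True
    \<comment> \<open>A singleton is separated and lies in its own ball, so \<open>N = 0\<close>
      leaves no point at all. The case is split off because the other one divides by
      \<open>N\<close>.\<close>
    have "E \<inter> mcball x r = {}"
    proof (rule ccontr)
      assume "E \<inter> mcball x r \<noteq> {}"
      then obtain y where y: "y \<in> E" "y \<in> M" using EM by auto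
      have "card {y} \<le> N" using y \<delta> by (intro N[of y]) (auto simp: delta_separated_def)
      then show False using True by simp
    qed
    then show ?thesis by simp
  next
    case False
    \<comment> \<open>The covering number is an infimum, so with \<open>N\<close> moved to the left
      each cover \<open>A\<close> can be compared separately with \<open>card A\<close>.\<close>
    have "ennreal (real (card (E \<inter> mcball x r)) / real N) \<le> covering_number \<delta> (E \<inter> mcball x r)"
      unfolding covering_number_def
    proof (rule INF_greatest)
      fix A assume "A \<in> {A. finite A \<and> A \<subseteq> M \<and> E \<inter> mcball x r \<subseteq> (\<Union>x\<in>A. mcball x \<delta>)}"
      then have A: "finite A" "A \<subseteq> M" "E \<inter> mcball x r \<subseteq> (\<Union>x\<in>A. mcball x \<delta>)" by auto
      have "card (E \<inter> mcball x r) \<le> card (\<Union>y\<in>A. E \<inter> mcball y \<delta>)"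
        using A E by (intro card_mono) auto
      also have "\<dots> \<le> (\<Sum>y\<in>A. card (E \<inter> mcball y \<delta>))" by (rule card_UN_le[OF A(1)])
      also have "\<dots> \<le> (\<Sum>y\<in>A. N)"
        using A E by (intro sum_mono N) (auto simp: delta_separated_def)
      finally have "real (card (E \<inter> mcball x r)) \<le> real (card A) * real N"
        by (simp flip: of_nat_mult)
      then have "real (card (E \<inter> mcball x r)) / real N \<le> real (card A)"
        using False by (simp add: divide_le_eq)
      then show "ennreal (real (card (E \<inter> mcball x r)) / real N) \<le> of_nat (card A)"
        by (simp add: ennreal_of_nat_eq_real_of_nat ennreal_leI)
    qed
    then have "ennreal (real N) * ennreal (real (card (E \<inter> mcball x r)) / real N)
        \<le> of_nat N * covering_number \<delta> (E \<inter> mcball x r)"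
      by (simp add: ennreal_of_nat_eq_real_of_nat mult_left_mono)
    then show ?thesis
      using False by (simp add: ennreal_of_nat_eq_real_of_nat flip: ennreal_mult)
  qed
  have "covering_number \<delta> (E \<inter> mcball x r) \<le> ennreal (C * r powr s) * covering_number \<delta> E"
    using E r by (auto simp: delta_set_def)
  also have "\<dots> \<le> ennreal (C * r powr s) * of_nat (card E)" using up by (rule mult_left_mono) simp
  finally have "of_nat (card (E \<inter> mcball x r)) \<le> of_nat N * (ennreal (C * r powr s) * of_nat (card E))"
    by (intro order_trans[OF low] mult_left_mono) auto
  then have "ennreal (real (card (E \<inter> mcball x r))) \<le> ennreal (real N * (C * r powr s * real (card E)))"
    using \<delta> by (simp add: ennreal_of_nat_eq_real_of_nat ennreal_mult)
  then show ?thesis using \<delta> by (subst (asm) ennreal_le_iff) (auto simp: mult.assoc)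
qed

section \<open>Hyperplanes and their normals\<close>

text \<open>A relation instead of a function: a hyperplane has two unit normals, and the sign is
  chosen later relative to a second hyperplane.\<close>

definition unit_normal :: "'a::euclidean_space set \<Rightarrow> 'a \<Rightarrow> bool" where
  "unit_normal V n \<longleftrightarrow> V \<in> hyperplanes \<and> norm n = 1 \<and> direction V = {x. n \<bullet> x = 0}"

lemma unit_normal_exists:
  fixes V :: "'a::euclidean_space set"
  assumes "V \<in> hyperplanes"
  shows "\<exists>n. unit_normal V n"
proof -
  have V: "affine V" "aff_dim V = int DIM('a) - 1" using assms by (auto simp: hyperplanes_def)
  have "\<exists>a b. a \<noteq> 0 \<and> affine hull V = {x. a \<bullet> x = b}"
    unfolding aff_dim_eq_hyperplane[symmetric] using V(2) by simp
  then obtain a b where ab: "a \<noteq> 0" "affine hull V = {x. a \<bullet> x = b}" by blast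
  have V_eq: "V = {x. a \<bullet> x = b}"
    using ab(2) V(1) affine_hull_eq[of V] by simp
  have "foot V + 0 \<in> (+) (foot V) ` direction V"
    using subspace_0[OF hyperplane_decomp(1)[OF assms]] by (rule imageI)
  then have p: "foot V \<in> V" using hyperplane_decomp(2)[OF assms] by simp
  have "direction V = {x. a \<bullet> x = 0}"
  proof
    show "direction V \<subseteq> {x. a \<bullet> x = 0}" by (auto simp: direction_def V_eq inner_diff_right)
    show "{x. a \<bullet> x = 0} \<subseteq> direction V"
    proof
      fix x assume x: "x \<in> {x. a \<bullet> x = 0}"
      have "foot V + x \<in> V" using x p by (simp add: V_eq inner_add_right)
      then have "\<exists>y z. x = y - z \<and> y \<in> V \<and> z \<in> V"
        using p by (intro exI[of _ "foot V + x"] exI[of _ "foot V"]) simp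
      then show "x \<in> direction V" by (simp only: direction_def mem_Collect_eq)
    qed
  qed
  then have "unit_normal V (a /\<^sub>R norm a)" using assms ab(1) by (simp add: unit_normal_def)
  then show ?thesis by blast
qed

lemma unit_normal_minus: "unit_normal V n \<Longrightarrow> unit_normal V (- n)"
  by (simp add: unit_normal_def)

lemma unit_normal_orth_proj:
  assumes "unit_normal V n"
  shows "orth_proj (direction V) x = x - (n \<bullet> x) *\<^sub>R n"
proof (rule orth_proj_eqI)
  have n: "n \<bullet> n = 1" using assms by (simp add: unit_normal_def norm_eq_1)
  have "V \<in> hyperplanes" using assms by (simp add: unit_normal_def)
  then show "subspace (direction V)" by (rule hyperplane_decomp(1))
  show "x - (n \<bullet> x) *\<^sub>R n \<in> direction V" using assms n by (simp add: unit_normal_def inner_diff_right)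
  show "x - (x - (n \<bullet> x) *\<^sub>R n) \<in> (direction V)\<^sup>\<bottom>"
    using assms by (auto simp: unit_normal_def orthogonal_comp_def orthogonal_def inner_commute)
qed

text \<open>The part of the foot orthogonal to \<open>n\<close> lies both in
  \<open>direction V\<close> and in its orthogonal complement, hence vanishes. So \<open>V\<close>
  is the level set of \<open>n\<close> at height \<open>n \<bullet> foot V\<close>.\<close>

lemma unit_normal_foot:
  assumes "unit_normal V n"
  shows "foot V = (n \<bullet> foot V) *\<^sub>R n" and "x \<in> V \<longleftrightarrow> n \<bullet> x = n \<bullet> foot V"
proof -
  have V: "V \<in> hyperplanes" and n: "n \<bullet> n = 1" and dir: "direction V = {x. n \<bullet> x = 0}"
    using assms by (auto simp: unit_normal_def norm_eq_1)
  obtain V0 a where a: "subspace V0" "a \<in> V0\<^sup>\<bottom>" "V = (+) a ` V0"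
    using V by (auto simp: hyperplanes_iff)
  have "foot V \<in> (direction V)\<^sup>\<bottom>" using a direction_foot by metis
  moreover have "foot V - (n \<bullet> foot V) *\<^sub>R n \<in> direction V"
    using n by (simp add: dir inner_diff_right)
  moreover have "(n \<bullet> foot V) *\<^sub>R n \<in> (direction V)\<^sup>\<bottom>"
    by (auto simp: dir orthogonal_comp_def orthogonal_def inner_commute)
  ultimately have "(foot V - (n \<bullet> foot V) *\<^sub>R n) \<bullet> (foot V - (n \<bullet> foot V) *\<^sub>R n) = 0"
    by (auto simp: orthogonal_comp_def orthogonal_def inner_diff_right)
  then show "foot V = (n \<bullet> foot V) *\<^sub>R n" by simp
  have "x \<in> V \<longleftrightarrow> x \<in> (+) (foot V) ` direction V" using hyperplane_decomp(2)[OF V] by simp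
  also have "\<dots> \<longleftrightarrow> x - foot V \<in> direction V"
    by (auto simp: image_iff algebra_simps intro: bexI[of _ "x - foot V"])
  finally show "x \<in> V \<longleftrightarrow> n \<bullet> x = n \<bullet> foot V" by (simp add: dir inner_diff_right)
qed

section \<open>The distance of hyperplanes in terms of their normals\<close>

text \<open>Each projection is the identity minus the rank-one projection onto the normal. The
  identities cancel in the difference, which reverses the order of \<open>n\<close> and
  \<open>m\<close>.\<close>

lemma dist_hyp_normals:
  assumes "unit_normal V n" "unit_normal W m"
  shows "dist_hyp V W = onorm (\<lambda>x. (m \<bullet> x) *\<^sub>R m - (n \<bullet> x) *\<^sub>R n) + norm (foot V - foot W)"
  using assms unit_normal_orth_proj[OF assms(1)] unit_normal_orth_proj[OF assms(2)]
  by (simp add: dist_hyp_def unit_normal_def)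

text \<open>The two occurrences of the normal in the rank-one operator are changed one at a time,
  each at the cost of \<open>norm (n - m)\<close>.\<close>

lemma onorm_normals_le:
  assumes "norm n = 1" "norm m = 1"
  shows "onorm (\<lambda>x. (m \<bullet> x) *\<^sub>R m - (n \<bullet> x) *\<^sub>R n) \<le> 2 * norm (n - m)"
proof (rule onorm_bound)
  fix x
  have "(m \<bullet> x) *\<^sub>R m - (n \<bullet> x) *\<^sub>R n = ((m - n) \<bullet> x) *\<^sub>R m + (n \<bullet> x) *\<^sub>R (m - n)"
    by (simp add: algebra_simps)
  also have "norm \<dots> \<le> \<bar>(m - n) \<bullet> x\<bar> * norm m + \<bar>n \<bullet> x\<bar> * norm (m - n)"
    by (metis norm_scaleR norm_triangle_ineq)
  also have "\<dots> \<le> (norm (m - n) * norm x) * norm m + (norm n * norm x) * norm (m - n)"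
    by (intro add_mono mult_right_mono Cauchy_Schwarz_ineq2) auto
  finally show "norm ((m \<bullet> x) *\<^sub>R m - (n \<bullet> x) *\<^sub>R n) \<le> 2 * norm (n - m) * norm x"
    using assms by (simp add: norm_minus_commute mult_ac)
qed simp

text \<open>The left side is the sine of the angle between the normals; it is the length of the
  image of the unit vector \<open>n\<close> under the operator.\<close>

lemma sin_le_onorm_normals:
  fixes n m :: "'a::euclidean_space"
  assumes "norm n = 1" "norm m = 1"
  shows "sqrt (1 - (n \<bullet> m)\<^sup>2) \<le> onorm (\<lambda>x. (m \<bullet> x) *\<^sub>R m - (n \<bullet> x) *\<^sub>R n)"
proof -
  have n: "n \<bullet> n = 1" "m \<bullet> m = 1" using assms by (simp_all add: norm_eq_1)
  have "norm ((m \<bullet> n) *\<^sub>R m - (n \<bullet> n) *\<^sub>R n) = sqrt (1 - (n \<bullet> m)\<^sup>2)"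
    using n by (simp add: norm_eq_sqrt_inner inner_diff_left inner_diff_right inner_commute
        power2_eq_square)
  moreover have "bounded_linear (\<lambda>x. (m \<bullet> x) *\<^sub>R m - (n \<bullet> x) *\<^sub>R n)"
    by (intro bounded_linear_intros)
  ultimately show ?thesis using onorm[of "\<lambda>x. (m \<bullet> x) *\<^sub>R m - (n \<bullet> x) *\<^sub>R n" n] assms by simp
qed

lemma inner_square_le_1:
  assumes "norm n = 1" "norm m = 1"
  shows "(n \<bullet> m)\<^sup>2 \<le> 1"
  using Cauchy_Schwarz_ineq2[of n m] assms abs_square_le_1 by auto

text \<open>With \<open>c = n \<bullet> m\<close> the squares are \<open>2 * (1 - c)\<close> and
  \<open>4 * (1 - c) * (1 + c)\<close>, and their difference \<open>(1 - c) * (2 + 4 * c)\<close> is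
  nonnegative for \<open>0 \<le> c \<le> 1\<close>. The sign condition excludes nearly opposite
  normals, whose sine is small although they are far apart.\<close>

lemma norm_diff_le_sin:
  fixes n m :: "'a::euclidean_space"
  assumes "norm n = 1" "norm m = 1" "0 \<le> n \<bullet> m"
  shows "norm (n - m) \<le> 2 * sqrt (1 - (n \<bullet> m)\<^sup>2)"
proof -
  have n: "n \<bullet> n = 1" "m \<bullet> m = 1" using assms by (simp_all add: norm_eq_1)
  have le: "n \<bullet> m \<le> 1" using norm_cauchy_schwarz[of n m] assms by simp
  have "(norm (n - m))\<^sup>2 = 2 - 2 * (n \<bullet> m)"
    using n by (simp add: power2_norm_eq_inner inner_diff_left inner_diff_right inner_commute)
  also have "\<dots> \<le> 4 * (1 - (n \<bullet> m)\<^sup>2)"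
  proof -
    have "0 \<le> (1 - n \<bullet> m) * (2 + 4 * (n \<bullet> m))" using le assms by simp
    then show ?thesis by (simp add: algebra_simps power2_eq_square)
  qed
  also have "\<dots> = (2 * sqrt (1 - (n \<bullet> m)\<^sup>2))\<^sup>2"
    using inner_square_le_1[OF assms(1,2)] by (simp add: power_mult_distrib)
  finally show ?thesis by (rule power2_le_imp_le) (simp add: inner_square_le_1[OF assms(1,2)])
qed

section \<open>Packing hyperplanes by normal and foot\<close>

text \<open>The foot is the point of \<open>V\<close> closest to the origin: its length is
  \<open>\<bar>n \<bullet> x\<bar>\<close> for every \<open>x\<close> in \<open>V\<close>.\<close>

lemma foot_norm_le_1:
  assumes "V \<in> hyperplanes" "V \<inter> cball 0 1 \<noteq> {}"
  shows "norm (foot V) \<le> 1"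
proof -
  obtain n where n: "unit_normal V n" using unit_normal_exists[OF assms(1)] by blast
  obtain x where x: "x \<in> V" "norm x \<le> 1" using assms(2) by auto
  have "norm (foot V) = \<bar>n \<bullet> foot V\<bar>"
    by (subst unit_normal_foot(1)[OF n]) (use n in \<open>simp add: unit_normal_def\<close>)
  also have "\<dots> = \<bar>n \<bullet> x\<bar>" using unit_normal_foot(2)[OF n] x by simp
  also have "\<dots> \<le> 1" using Cauchy_Schwarz_ineq2[of n x] n x by (simp add: unit_normal_def)
  finally show ?thesis .
qed

text \<open>The factor 3 is 2 from the operator norm plus 1 from the feet. It turns
  \<open>\<delta>\<close>-separated hyperplanes into pairs \<open>(normal, foot)\<close> that are
  \<open>\<delta> / 3\<close>-separated, for any choice of signs.\<close>

lemma dist_hyp_le_normal_foot: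
  assumes "unit_normal V n" "unit_normal W m"
  shows "dist_hyp V W \<le> 3 * dist (n, foot V) (m, foot W)"
proof -
  have "dist n m \<le> dist (n, foot V) (m, foot W)" "dist (foot V) (foot W) \<le> dist (n, foot V) (m, foot W)"
    using dist_fst_le[of "(n, foot V)" "(m, foot W)"] dist_snd_le[of "(n, foot V)" "(m, foot W)"] by auto
  then show ?thesis
    using dist_hyp_normals[OF assms] onorm_normals_le[of n m] assms
    by (auto simp: unit_normal_def dist_norm)
qed

text \<open>The pairs \<open>(normal, foot)\<close> lie in the ball of radius 2, which is
  \<open>6 / \<delta>\<close> times their separation \<open>\<delta> / 3\<close>. The packing bound
  obtained this way depends on \<open>\<delta>\<close>, so only finiteness is kept.\<close>

lemma hyperplane_separated_finite:
  fixes H :: "'a::euclidean_space set set"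
  assumes H: "H \<subseteq> hyperplanes" "\<forall>V\<in>H. V \<inter> cball 0 1 \<noteq> {}" and "0 < \<delta>"
    and sep: "Hyp.delta_separated \<delta> H"
  shows "finite H"
proof -
  obtain n where n: "\<And>V. V \<in> hyperplanes \<Longrightarrow> unit_normal V (n V :: 'a)"
    using unit_normal_exists by metis
  obtain N :: nat where N: "\<forall>\<eta> (z::'a\<times>'a) (S::'a set set) f.
    0 < \<eta> \<longrightarrow> f ` S \<subseteq> cball z ((6 / \<delta>) * \<eta>) \<longrightarrow> (\<forall>u\<in>S. \<forall>v\<in>S. u \<noteq> v \<longrightarrow> \<eta> \<le> dist (f u) (f v)) \<longrightarrow>
    finite S \<and> card S \<le> N"
    using separated_map_card_bound[where 'a="'a set" and 'b="'a\<times>'a", of "6 / \<delta>"] by (rule exE)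
  have "(\<lambda>V. (n V, foot V)) ` H \<subseteq> cball 0 ((6 / \<delta>) * (\<delta> / 3))"
  proof (rule image_subsetI)
    fix V assume V: "V \<in> H"
    have "norm (n V, foot V) \<le> norm (n V) + norm (foot V)" by (rule norm_Pair_le)
    also have "\<dots> \<le> 2" using V H n foot_norm_le_1[of V] by (auto simp: unit_normal_def)
    finally show "(n V, foot V) \<in> cball 0 ((6 / \<delta>) * (\<delta> / 3))"
      using \<open>0 < \<delta>\<close> by simp
  qed
  moreover have "\<forall>u\<in>H. \<forall>v\<in>H. u \<noteq> v \<longrightarrow> \<delta> / 3 \<le> dist (n u, foot u) (n v, foot v)"
  proof (intro ballI impI)
    fix u v assume uv: "u \<in> H" "v \<in> H" "u \<noteq> v"
    then have "\<delta> \<le> dist_hyp u v" using sep by (simp add: Hyp.delta_separated_def)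
    moreover have "unit_normal u (n u)" "unit_normal v (n v)" using n uv H by blast+
    ultimately show "\<delta> / 3 \<le> dist (n u, foot u) (n v, foot v)"
      using dist_hyp_le_normal_foot[of u "n u" v "n v"] by linarith
  qed
  moreover have "\<delta> / 3 > 0" using \<open>0 < \<delta>\<close> by simp
  ultimately show ?thesis
    using N[THEN spec, of "\<delta> / 3", THEN spec, of 0, THEN spec, of H, THEN spec, of "\<lambda>V. (n V, foot V)"]
    by simp
qed

text \<open>Orienting all normals towards that of the centre makes \<open>(normal, foot)\<close> a
  bi-Lipschitz chart on the ball.\<close>

lemma hyperplane_ball_card_bound:
  "\<exists>N::nat. \<forall>\<delta>>0. \<forall>V \<in> hyperplanes. \<forall>S :: 'a::euclidean_space set set.
     S \<subseteq> Hyp.mcball V \<delta> \<longrightarrow> Hyp.delta_separated \<delta> S \<longrightarrow> card S \<le> N"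
proof -
  \<comment> \<open>The chart maps a ball of radius \<open>\<delta>\<close> into one of radius
    \<open>3 * \<delta>\<close> and keeps separation \<open>\<delta> / 3\<close>; the ratio is
    9.\<close>
  obtain N :: nat where N: "\<forall>\<eta> (z::'a\<times>'a) (S::'a set set) f.
    0 < \<eta> \<longrightarrow> f ` S \<subseteq> cball z (9 * \<eta>) \<longrightarrow> (\<forall>u\<in>S. \<forall>v\<in>S. u \<noteq> v \<longrightarrow> \<eta> \<le> dist (f u) (f v)) \<longrightarrow>
    finite S \<and> card S \<le> N"
    using separated_map_card_bound[where 'a="'a set" and 'b="'a\<times>'a", of 9] by (rule exE)
  show ?thesis
  proof (intro exI allI impI ballI)
    fix \<delta> :: real and V :: "'a set" and S
    assume \<delta>: "0 < \<delta>" and V: "V \<in> hyperplanes" and S: "S \<subseteq> Hyp.mcball V \<delta>"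
      and sep: "Hyp.delta_separated \<delta> S"
    obtain m where m: "unit_normal V m" using unit_normal_exists V by blast
    have "\<exists>n. unit_normal W n \<and> 0 \<le> m \<bullet> n" if "W \<in> hyperplanes" for W
    proof -
      obtain n where n: "unit_normal W n" using unit_normal_exists \<open>W \<in> hyperplanes\<close> by blast
      show ?thesis
      proof (cases "0 \<le> m \<bullet> n")
        case False
        then have "unit_normal W (- n) \<and> 0 \<le> m \<bullet> (- n)" using unit_normal_minus n by simp
        then show ?thesis by blast
      qed (use n in blast)
    qed
    then obtain n where n: "\<And>W. W \<in> hyperplanes \<Longrightarrow> unit_normal W (n W) \<and> 0 \<le> m \<bullet> n W"
      by metis
    have "(\<lambda>W. (n W, foot W)) ` S \<subseteq> cball (m, foot V) (9 * (\<delta> / 3))"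
    proof (rule image_subsetI)
      fix W assume "W \<in> S"
      then have W: "W \<in> hyperplanes" "dist_hyp V W \<le> \<delta>" using S by auto
      have u: "norm m = 1" "norm (n W) = 1" using n[OF W(1)] m by (auto simp: unit_normal_def)
      have d: "dist_hyp V W = onorm (\<lambda>x. (n W \<bullet> x) *\<^sub>R n W - (m \<bullet> x) *\<^sub>R m) + norm (foot V - foot W)"
        using dist_hyp_normals m n W by blast
      have "norm (m - n W) \<le> 2 * onorm (\<lambda>x. (n W \<bullet> x) *\<^sub>R n W - (m \<bullet> x) *\<^sub>R m)"
        using norm_diff_le_sin[OF u] sin_le_onorm_normals[OF u] n[OF W(1)] by linarith
      moreover have "norm (m - n W, foot V - foot W) \<le> norm (m - n W) + norm (foot V - foot W)"
        by (rule norm_Pair_le)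
      ultimately have "norm (m - n W, foot V - foot W) \<le> 3 * \<delta>"
        using d W \<delta> norm_ge_zero[of "foot V - foot W"] by linarith
      then show "(n W, foot W) \<in> cball (m, foot V) (9 * (\<delta> / 3))"
        by (simp add: dist_norm)
    qed
    moreover have "\<forall>u\<in>S. \<forall>v\<in>S. u \<noteq> v \<longrightarrow> \<delta> / 3 \<le> dist (n u, foot u) (n v, foot v)"
    proof (intro ballI impI)
      fix u v assume uv: "u \<in> S" "v \<in> S" "u \<noteq> v"
      then have "\<delta> \<le> dist_hyp u v" "u \<in> hyperplanes" "v \<in> hyperplanes"
        using sep by (auto simp: Hyp.delta_separated_def)
      moreover from this have "unit_normal u (n u)" "unit_normal v (n v)" using n by blast+
      ultimately show "\<delta> / 3 \<le> dist (n u, foot u) (n v, foot v)"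
        using dist_hyp_le_normal_foot[of u "n u" v "n v"] by linarith
    qed
    moreover have "\<delta> / 3 > 0" using \<delta> by simp
    ultimately show "card S \<le> N"
      using N[THEN spec, of "\<delta> / 3", THEN spec, of "(m, foot V)", THEN spec, of S,
          THEN spec, of "\<lambda>W. (n W, foot W)"] by simp
  qed
qed

section \<open>Points near one or two hyperplanes\<close>

text \<open>Starting from a point that minimises \<open>\<phi>\<close>, the range of
  \<open>\<phi>\<close> is cut into intervals of length \<open>\<eta>\<close>. At most
  \<open>L / \<eta> + 1\<close> of them are occupied, and each holds at most \<open>M\<close>
  points.\<close>

lemma card_le_slabs:
  fixes \<phi> :: "'a \<Rightarrow> real"
  assumes "finite S" "0 < \<eta>" "0 \<le> M" "0 \<le> L"
    and L: "\<And>x y. x \<in> S \<Longrightarrow> y \<in> S \<Longrightarrow> \<bar>\<phi> x - \<phi> y\<bar> \<le> L"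
    and M: "\<And>T. T \<subseteq> S \<Longrightarrow> \<forall>x\<in>T. \<forall>y\<in>T. \<bar>\<phi> x - \<phi> y\<bar> \<le> \<eta> \<Longrightarrow> real (card T) \<le> M"
  shows "real (card S) \<le> (L / \<eta> + 1) * M"
proof (cases "S = {}")
  case True
  then show ?thesis using assms by simp
next
  case False
  obtain x0 where x0: "x0 \<in> S" "\<And>x. x \<in> S \<Longrightarrow> \<phi> x0 \<le> \<phi> x"
    using arg_min_if_finite[OF \<open>finite S\<close> False, of \<phi>] by (metis not_le)
  define k where "k x = \<lfloor>(\<phi> x - \<phi> x0) / \<eta>\<rfloor>" for x
  define I where "I = {0..\<lfloor>L / \<eta>\<rfloor>}"
  have k: "k x \<in> I" if "x \<in> S" for x
    using L[OF that x0(1)] x0(2)[OF that] \<open>0 < \<eta>\<close>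
    by (auto simp: k_def I_def intro!: floor_mono divide_right_mono)
  have "S = (\<Union>i\<in>I. {x \<in> S. k x = i})" using k by auto
  then have "card S \<le> (\<Sum>i\<in>I. card {x \<in> S. k x = i})"
    using card_UN_le[of I "\<lambda>i. {x \<in> S. k x = i}"] by (simp add: I_def)
  then have "real (card S) \<le> real (\<Sum>i\<in>I. card {x \<in> S. k x = i})"
    by (simp only: of_nat_le_iff)
  also have "\<dots> = (\<Sum>i\<in>I. real (card {x \<in> S. k x = i}))" by simp
  also have "\<dots> \<le> (\<Sum>i\<in>I. M)"
  proof (rule sum_mono)
    fix i
    show "real (card {x \<in> S. k x = i}) \<le> M"
    proof (rule M, blast, intro ballI)
      fix x y assume "x \<in> {x \<in> S. k x = i}" "y \<in> {x \<in> S. k x = i}"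
      then have "\<lfloor>(\<phi> x - \<phi> x0) / \<eta>\<rfloor> = \<lfloor>(\<phi> y - \<phi> x0) / \<eta>\<rfloor>" by (auto simp: k_def)
      then have "\<bar>(\<phi> x - \<phi> x0) / \<eta> - (\<phi> y - \<phi> x0) / \<eta>\<bar> \<le> 1" by linarith
      then have "\<bar>(\<phi> x - \<phi> y) / \<eta>\<bar> \<le> 1" by (simp add: diff_divide_distrib)
      then show "\<bar>\<phi> x - \<phi> y\<bar> \<le> \<eta>" using \<open>0 < \<eta>\<close> by simp
    qed
  qed
  also have "\<dots> = real (nat (\<lfloor>L / \<eta>\<rfloor> + 1)) * M" by (simp add: I_def)
  also have "\<dots> \<le> (L / \<eta> + 1) * M"
    using assms by (intro mult_right_mono) auto
  finally show ?thesis .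
qed

text \<open>One slab count for each function in \<open>J\<close>: every slab of
  \<open>\<phi> j\<close> is subdivided by the remaining functions.\<close>

lemma card_le_boxes:
  fixes \<phi> :: "'j \<Rightarrow> 'a \<Rightarrow> real"
  assumes "finite J" "finite S" "0 < \<eta>" "0 \<le> M" "0 \<le> L"
    and "\<And>j x y. j \<in> J \<Longrightarrow> x \<in> S \<Longrightarrow> y \<in> S \<Longrightarrow> \<bar>\<phi> j x - \<phi> j y\<bar> \<le> L"
    and "\<And>T. T \<subseteq> S \<Longrightarrow> \<forall>j\<in>J. \<forall>x\<in>T. \<forall>y\<in>T. \<bar>\<phi> j x - \<phi> j y\<bar> \<le> \<eta> \<Longrightarrow> real (card T) \<le> M"
  shows "real (card S) \<le> (L / \<eta> + 1) ^ card J * M"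
  using assms(1,2,6,7)
proof (induction J arbitrary: S rule: finite_induct)
  case empty
  then show ?case by simp
next
  case (insert j J)
  have "real (card S) \<le> (L / \<eta> + 1) * ((L / \<eta> + 1) ^ card J * M)"
  proof (rule card_le_slabs[where \<phi> = "\<phi> j"])
    fix T assume T: "T \<subseteq> S" "\<forall>x\<in>T. \<forall>y\<in>T. \<bar>\<phi> j x - \<phi> j y\<bar> \<le> \<eta>"
    show "real (card T) \<le> (L / \<eta> + 1) ^ card J * M"
    proof (rule insert.IH)
      show "finite T" using T(1) \<open>finite S\<close> by (rule finite_subset)
      show "\<bar>\<phi> i x - \<phi> i y\<bar> \<le> L" if "i \<in> J" "x \<in> T" "y \<in> T" for i x y
        using that T(1) by (intro insert.prems(2)) auto
      show "real (card U) \<le> M"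
        if "U \<subseteq> T" "\<forall>i\<in>J. \<forall>x\<in>U. \<forall>y\<in>U. \<bar>\<phi> i x - \<phi> i y\<bar> \<le> \<eta>" for U
      proof (rule insert.prems(3))
        show "U \<subseteq> S" using that(1) T(1) by blast
        show "\<forall>i\<in>insert j J. \<forall>x\<in>U. \<forall>y\<in>U. \<bar>\<phi> i x - \<phi> i y\<bar> \<le> \<eta>"
          using that T(2) by (simp add: subset_iff)
      qed
    qed
  next
    show "finite S" "0 < \<eta>" "0 \<le> L" by fact+
    show "0 \<le> (L / \<eta> + 1) ^ card J * M" using \<open>0 \<le> M\<close> \<open>0 < \<eta>\<close> \<open>0 \<le> L\<close> by simp
    show "\<bar>\<phi> j x - \<phi> j y\<bar> \<le> L" if "x \<in> S" "y \<in> S" for x y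
      using that by (intro insert.prems(2)) auto
  qed
  then show ?case using insert.hyps by (simp add: mult.assoc)
qed

text \<open>The norm is at most the sum of the absolute coordinates, so some coordinate carries its
  average share.\<close>

lemma exists_large_coordinate:
  fixes v :: "'a::euclidean_space"
  shows "\<exists>b\<in>Basis. norm v \<le> real DIM('a) * \<bar>v \<bullet> b\<bar>"
proof (rule ccontr)
  assume "\<not> ?thesis"
  then have "\<forall>b\<in>Basis. \<bar>v \<bullet> b\<bar> < norm v / real DIM('a)"
    by (simp add: not_le less_divide_eq mult.commute)
  then have "(\<Sum>b\<in>Basis. \<bar>v \<bullet> b\<bar>) < (\<Sum>b\<in>(Basis::'a set). norm v / real DIM('a))"
    by (intro sum_strict_mono) auto
  then show False using norm_le_l1[of v] by simp
qed

text \<open>This explains the side length \<open>\<delta> / DIM('a)\<close> of all boxes below: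
  coordinates confined that much change the inner product with a unit vector by at most
  \<open>\<delta>\<close> in total.\<close>

lemma abs_sum_coordinates_le:
  fixes n u :: "'a::euclidean_space"
  assumes "norm n = 1" "J \<subseteq> Basis" "0 \<le> \<delta>"
    and "\<And>b. b \<in> J \<Longrightarrow> \<bar>u \<bullet> b\<bar> \<le> \<delta> / real DIM('a)"
  shows "\<bar>\<Sum>b\<in>J. (n \<bullet> b) * (u \<bullet> b)\<bar> \<le> \<delta>"
proof -
  have "\<bar>\<Sum>b\<in>J. (n \<bullet> b) * (u \<bullet> b)\<bar> \<le> (\<Sum>b\<in>J. \<bar>(n \<bullet> b) * (u \<bullet> b)\<bar>)" by (rule sum_abs)
  also have "\<dots> \<le> (\<Sum>b\<in>J. 1 * (\<delta> / real DIM('a)))"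
  proof (rule sum_mono)
    fix b assume b: "b \<in> J"
    then have "\<bar>n \<bullet> b\<bar> \<le> 1" using Basis_le_norm[of b n] assms by auto
    then show "\<bar>(n \<bullet> b) * (u \<bullet> b)\<bar> \<le> 1 * (\<delta> / real DIM('a))"
      unfolding abs_mult using assms(4)[OF b] by (intro mult_mono) auto
  qed
  also have "\<dots> \<le> (\<Sum>b\<in>(Basis::'a set). 1 * (\<delta> / real DIM('a)))"
    using assms by (intro sum_mono2) auto
  also have "\<dots> = \<delta>" by simp
  finally show ?thesis .
qed

section \<open>Points close to one or two level sets\<close>

text \<open>When all coordinates but the \<open>i\<close>-th are confined, closeness to the
  hyperplane confines the \<open>i\<close>-th as well, because its coefficient in \<open>n\<close>
  is at least \<open>1 / DIM('a)\<close>. The resulting interval of length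
  \<open>O(\<delta>)\<close> is cut into pieces whose points lie in a single ball of radius
  \<open>\<delta>\<close>.\<close>

lemma card_le_near_hyperplane_in_column:
  fixes T :: "'a::euclidean_space set"
  assumes "finite T" and \<delta>: "0 < \<delta>" and C: "0 \<le> C" and "0 \<le> M"
    and n: "norm n = 1" and i: "i \<in> Basis" "1 \<le> real DIM('a) * \<bar>n \<bullet> i\<bar>"
    and osc: "\<And>b x y. b \<in> Basis - {i} \<Longrightarrow> x \<in> T \<Longrightarrow> y \<in> T \<Longrightarrow> \<bar>x \<bullet> b - y \<bullet> b\<bar> \<le> \<delta> / real DIM('a)"
    and near: "\<And>x y. x \<in> T \<Longrightarrow> y \<in> T \<Longrightarrow> \<bar>n \<bullet> x - n \<bullet> y\<bar> \<le> 2 * C * \<delta>"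
    and M: "\<And>U x. U \<subseteq> T \<Longrightarrow> U \<subseteq> cball x \<delta> \<Longrightarrow> real (card U) \<le> M"
  shows "real (card T) \<le> ((2 * C + 1) * real DIM('a) ^ 2 + 1) * M"
proof -
  let ?D = "real DIM('a)"
  have D: "?D > 0" by simp
  \<comment> \<open>In \<open>2 * C + 1\<close> the term \<open>2 * C\<close> is the width of the
    neighbourhood and 1 accounts for the other coordinates; \<open>?D\<close> comes from dividing by
    \<open>n \<bullet> i\<close>.\<close>
  have "real (card T) \<le> (?D * (2 * C + 1) * \<delta> / (\<delta> / ?D) + 1) * M"
  proof (rule card_le_slabs[where \<phi> = "\<lambda>x. x \<bullet> i"])
    fix x y assume xy: "x \<in> T" "y \<in> T"
    define u where "u = x - y"
    have "n \<bullet> u = (\<Sum>b\<in>Basis. (n \<bullet> b) * (u \<bullet> b))" by (rule euclidean_inner)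
    also have "\<dots> = (n \<bullet> i) * (u \<bullet> i) + (\<Sum>b\<in>Basis - {i}. (n \<bullet> b) * (u \<bullet> b))"
      using i by (intro sum.remove) auto
    finally have "n \<bullet> u = (n \<bullet> i) * (u \<bullet> i) + (\<Sum>b\<in>Basis - {i}. (n \<bullet> b) * (u \<bullet> b))" .
    moreover have "\<bar>\<Sum>b\<in>Basis - {i}. (n \<bullet> b) * (u \<bullet> b)\<bar> \<le> \<delta>"
      using n osc xy \<delta> by (intro abs_sum_coordinates_le) (auto simp: u_def inner_diff_left)
    moreover have "\<bar>n \<bullet> u\<bar> \<le> 2 * C * \<delta>" using near[OF xy] by (simp add: u_def inner_diff_right)
    ultimately have "\<bar>(n \<bullet> i) * (u \<bullet> i)\<bar> \<le> 2 * C * \<delta> + \<delta>" by linarith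
    then have *: "?D * (\<bar>n \<bullet> i\<bar> * \<bar>u \<bullet> i\<bar>) \<le> ?D * (2 * C * \<delta> + \<delta>)"
      by (intro mult_left_mono) (auto simp: abs_mult)
    have "1 * \<bar>u \<bullet> i\<bar> \<le> ?D * \<bar>n \<bullet> i\<bar> * \<bar>u \<bullet> i\<bar>" using i by (intro mult_right_mono) auto
    then show "\<bar>x \<bullet> i - y \<bullet> i\<bar> \<le> ?D * (2 * C + 1) * \<delta>"
      using * by (simp add: u_def inner_diff_left algebra_simps)
  next
    fix U assume U: "U \<subseteq> T" "\<forall>x\<in>U. \<forall>y\<in>U. \<bar>x \<bullet> i - y \<bullet> i\<bar> \<le> \<delta> / ?D"
    show "real (card U) \<le> M"
    proof (cases "U = {}")
      case False
      then obtain x where x: "x \<in> U" by blast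
      have "U \<subseteq> cball x \<delta>"
      proof
        fix y assume y: "y \<in> U"
        have "norm (x - y) \<le> (\<Sum>b\<in>Basis. \<bar>(x - y) \<bullet> b\<bar>)" by (rule norm_le_l1)
        also have "\<dots> \<le> (\<Sum>b\<in>(Basis::'a set). \<delta> / ?D)"
        proof (rule sum_mono)
          fix b :: 'a assume "b \<in> Basis"
          then show "\<bar>(x - y) \<bullet> b\<bar> \<le> \<delta> / ?D"
            using osc[of b x y] U x y by (cases "b = i") (auto simp: inner_diff_left subset_iff)
        qed
        also have "\<dots> = \<delta>" by simp
        finally show "y \<in> cball x \<delta>" by (simp add: dist_norm)
      qed
      then show ?thesis by (rule M[OF U(1)])
    qed (use \<open>0 \<le> M\<close> in simp)
  qed (use assms(1,2,3,4) D in auto)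
  also have "?D * (2 * C + 1) * \<delta> / (\<delta> / ?D) = (2 * C + 1) * ?D ^ 2"
    using \<delta> by (simp add: power2_eq_square)
  finally show ?thesis .
qed

lemma coordinate_diff_le_2:
  fixes x y :: "'a::euclidean_space"
  assumes "x \<in> cball 0 1" "y \<in> cball 0 1" "b \<in> Basis"
  shows "\<bar>x \<bullet> b - y \<bullet> b\<bar> \<le> 2"
  using Basis_le_norm[OF assms(3), of x] Basis_le_norm[OF assms(3), of y] assms by auto

lemma box_factor_le:
  fixes D \<delta> :: real
  assumes "0 < \<delta>" "\<delta> < 1" "0 < D"
  shows "(2 / (\<delta> / D) + 1) ^ k \<le> (2 * D + 1) ^ k / \<delta> ^ k"
proof -
  have "2 / (\<delta> / D) + 1 \<le> (2 * D + 1) / \<delta>"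
    using assms by (simp add: field_simps)
  then have "(2 / (\<delta> / D) + 1) ^ k \<le> ((2 * D + 1) / \<delta>) ^ k"
    using assms by (intro power_mono) auto
  then show ?thesis by (simp add: power_divide)
qed

text \<open>A grid in the \<open>DIM('a) - 1\<close> coordinates other than the dominant one of
  \<open>n\<close> has \<open>O(1 / \<delta> ^ (DIM('a) - 1))\<close> cells, and the column over
  each contributes \<open>O(M)\<close> points.\<close>

lemma card_le_near_hyperplane:
  fixes S :: "'a::euclidean_space set"
  assumes S: "finite S" "S \<subseteq> cball 0 1" and \<delta>: "0 < \<delta>" "\<delta> < 1" and C: "0 \<le> C" and "0 \<le> M"
    and n: "norm n = 1"
    and near: "\<And>x y. x \<in> S \<Longrightarrow> y \<in> S \<Longrightarrow> \<bar>n \<bullet> x - n \<bullet> y\<bar> \<le> 2 * C * \<delta>"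
    and M: "\<And>U x. U \<subseteq> S \<Longrightarrow> U \<subseteq> cball x \<delta> \<Longrightarrow> real (card U) \<le> M"
  shows "real (card S) \<le> (2 * real DIM('a) + 1) ^ (DIM('a) - 1) * ((2 * C + 1) * real DIM('a) ^ 2 + 1)
    * M / \<delta> ^ (DIM('a) - 1)"
proof -
  let ?D = "real DIM('a)"
  let ?A = "(2 * C + 1) * ?D ^ 2 + 1"
  obtain i where i: "i \<in> Basis" "1 \<le> ?D * \<bar>n \<bullet> i\<bar>" using exists_large_coordinate[of n] n by auto
  have "real (card S) \<le> (2 / (\<delta> / ?D) + 1) ^ card (Basis - {i}) * (?A * M)"
  proof (rule card_le_boxes[where \<phi> = "\<lambda>b x. x \<bullet> b"])
    show "\<bar>x \<bullet> j - y \<bullet> j\<bar> \<le> 2" if "j \<in> Basis - {i}" "x \<in> S" "y \<in> S" for j x y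
      using that S by (intro coordinate_diff_le_2) auto
    fix T assume T: "T \<subseteq> S" "\<forall>j\<in>Basis - {i}. \<forall>x\<in>T. \<forall>y\<in>T. \<bar>x \<bullet> j - y \<bullet> j\<bar> \<le> \<delta> / ?D"
    show "real (card T) \<le> ?A * M"
    proof (rule card_le_near_hyperplane_in_column[OF _ \<delta>(1) C \<open>0 \<le> M\<close> n i])
      show "finite T" using S T finite_subset by blast
      show "\<bar>x \<bullet> b - y \<bullet> b\<bar> \<le> \<delta> / ?D" if "b \<in> Basis - {i}" "x \<in> T" "y \<in> T" for b x y
        using T(2) that by blast
      show "\<bar>n \<bullet> x - n \<bullet> y\<bar> \<le> 2 * C * \<delta>" if "x \<in> T" "y \<in> T" for x y
        using near that T(1) by blast
      show "real (card U) \<le> M" if "U \<subseteq> T" "U \<subseteq> cball x \<delta>" for U x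
        using that T(1) by (intro M[of U x]) auto
    qed
  qed (use \<delta> \<open>0 \<le> M\<close> C S(1) in auto)
  also have "card (Basis - {i}) = DIM('a) - 1" using i by (simp add: card_Diff_singleton)
  also have "(2 / (\<delta> / ?D) + 1) ^ (DIM('a) - 1) * (?A * M)
      \<le> ((2 * ?D + 1) ^ (DIM('a) - 1) / \<delta> ^ (DIM('a) - 1)) * (?A * M)"
    using \<delta> C \<open>0 \<le> M\<close> by (intro mult_right_mono box_factor_le) auto
  finally show ?thesis by (simp add: mult_ac)
qed

text \<open>Some \<open>2 \<times> 2\<close> minor of the two normals is comparable to the sine of the angle between them.
  Fixing the other coordinates up to \<open>\<delta>\<close>, Cramer's rule confines the \<open>j\<close>-th coordinate to an
  interval of length about \<open>\<delta>\<close> divided by that sine.\<close>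

lemma card_le_near_two_hyperplanes:
  fixes S :: "'a::euclidean_space set"
  assumes S: "finite S" "S \<subseteq> cball 0 1" and \<delta>: "0 < \<delta>" "\<delta> < 1" and C: "0 \<le> C" and "0 \<le> M"
    and n: "norm n = 1" and m: "norm m = 1" and \<theta>: "\<theta> = sqrt (1 - (n \<bullet> m)\<^sup>2)" "0 < \<theta>"
    and near: "\<And>x y. x \<in> S \<Longrightarrow> y \<in> S \<Longrightarrow> \<bar>n \<bullet> x - n \<bullet> y\<bar> \<le> 2 * C * \<delta>"
    and near': "\<And>x y. x \<in> S \<Longrightarrow> y \<in> S \<Longrightarrow> \<bar>m \<bullet> x - m \<bullet> y\<bar> \<le> 2 * C * \<delta>"
    and M: "\<And>U x. U \<subseteq> S \<Longrightarrow> U \<subseteq> cball x \<delta> \<Longrightarrow> real (card U) \<le> M"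
  shows "real (card S) \<le> (2 * real DIM('a) + 1) ^ (DIM('a) - 2) *
      ((2 * (2 * C + 1) * real DIM('a) ^ 3 + 1) * ((2 * C + 1) * real DIM('a) ^ 2 + 1))
    * M / (\<delta> ^ (DIM('a) - 2) * \<theta>)"
proof -
  let ?D = "real DIM('a)"
  let ?A = "(2 * C + 1) * ?D ^ 2 + 1"
  obtain i where i: "i \<in> Basis" "1 \<le> ?D * \<bar>n \<bullet> i\<bar>" using exists_large_coordinate[of n] n by auto
  \<comment> \<open>The coordinate \<open>w \<bullet> j\<close> is the minor of \<open>n\<close> and
    \<open>m\<close> in the columns \<open>i\<close> and \<open>j\<close>; a large coordinate of
    \<open>w\<close> therefore selects a large minor.\<close>
  define w where "w = (n \<bullet> i) *\<^sub>R m - (m \<bullet> i) *\<^sub>R n"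
  obtain j where j: "j \<in> Basis" "norm w \<le> ?D * \<bar>w \<bullet> j\<bar>" using exists_large_coordinate[of w] by auto
  have \<theta>1: "\<theta> \<le> 1" using \<theta> inner_square_le_1[OF n m] by simp
  have "\<bar>n \<bullet> i\<bar> * \<theta> \<le> norm w"
  proof -
    have nn: "n \<bullet> n = 1" "m \<bullet> m = 1" using n m by (simp_all add: norm_eq_1)
    have "(norm w)\<^sup>2 = (n \<bullet> i)\<^sup>2 - 2 * (n \<bullet> i) * (m \<bullet> i) * (n \<bullet> m) + (m \<bullet> i)\<^sup>2"
      unfolding power2_norm_eq_inner using nn
      by (simp add: w_def inner_diff_left inner_diff_right inner_commute[of m n] power2_eq_square
          right_diff_distrib)
    \<comment> \<open>Completing the square in \<open>m \<bullet> i\<close> leaves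
      \<open>(n \<bullet> i)\<^sup>2\<close> times the squared sine as a lower bound.\<close>
    also have "\<dots> = (m \<bullet> i - (n \<bullet> i) * (n \<bullet> m))\<^sup>2 + (n \<bullet> i)\<^sup>2 * (1 - (n \<bullet> m)\<^sup>2)"
      by (simp add: power2_eq_square algebra_simps)
    also have "\<dots> \<ge> (\<bar>n \<bullet> i\<bar> * \<theta>)\<^sup>2"
      using inner_square_le_1[OF n m] by (simp add: \<theta> power_mult_distrib)
    finally show ?thesis by (rule power2_le_imp_le) simp
  qed
  then have "?D * (\<bar>n \<bullet> i\<bar> * \<theta>) \<le> ?D * (?D * \<bar>w \<bullet> j\<bar>)"
    using j by (intro mult_left_mono) auto
  moreover have "1 * \<theta> \<le> ?D * \<bar>n \<bullet> i\<bar> * \<theta>" using i \<theta> by (intro mult_right_mono) auto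
  ultimately have "\<theta> \<le> ?D * (?D * \<bar>w \<bullet> j\<bar>)" by (simp only: mult_1_left mult.assoc)
  then have w\<theta>: "\<theta> \<le> ?D ^ 2 * \<bar>w \<bullet> j\<bar>" by (simp only: power2_eq_square mult.assoc)
  have wj: "w \<bullet> b = (n \<bullet> i) * (m \<bullet> b) - (m \<bullet> i) * (n \<bullet> b)" for b
    by (simp add: w_def inner_diff_left)
  have "w \<bullet> i = 0" by (simp add: wj)
  with w\<theta> \<theta> have ij: "i \<noteq> j" by auto
  \<comment> \<open>Three stages: boxes in the \<open>DIM('a) - 2\<close> coordinates of
    \<open>?J\<close>, then slabs of the \<open>j\<close>-th coordinate, whose range is
    \<open>?L\<close>, then the column in direction \<open>i\<close>.\<close>
  let ?J = "Basis - {i} - {j}"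
  let ?L = "2 * (2 * C + 1) * \<delta> * ?D ^ 2 / \<theta>"
  have "real (card S) \<le> (2 / (\<delta> / ?D) + 1) ^ card ?J * ((?L / (\<delta> / ?D) + 1) * (?A * M))"
  proof (rule card_le_boxes[where \<phi> = "\<lambda>b x. x \<bullet> b"])
    show "\<bar>x \<bullet> b - y \<bullet> b\<bar> \<le> 2" if "b \<in> ?J" "x \<in> S" "y \<in> S" for b x y
      using that S by (intro coordinate_diff_le_2) auto
    fix T assume T: "T \<subseteq> S" "\<forall>b\<in>?J. \<forall>x\<in>T. \<forall>y\<in>T. \<bar>x \<bullet> b - y \<bullet> b\<bar> \<le> \<delta> / ?D"
    have "finite T" using S T finite_subset by blast
    show "real (card T) \<le> (?L / (\<delta> / ?D) + 1) * (?A * M)"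
    proof (rule card_le_slabs[where \<phi> = "\<lambda>x. x \<bullet> j"])
      fix x y assume xy: "x \<in> T" "y \<in> T"
      define u where "u = x - y"
      have small: "\<bar>(v \<bullet> i) * (u \<bullet> i) + (v \<bullet> j) * (u \<bullet> j)\<bar> \<le> (2 * C + 1) * \<delta>"
        if v: "norm v = 1" "\<bar>v \<bullet> u\<bar> \<le> 2 * C * \<delta>" for v
      proof -
        have "v \<bullet> u = (\<Sum>b\<in>Basis. (v \<bullet> b) * (u \<bullet> b))" by (rule euclidean_inner)
        also have "\<dots> = (v \<bullet> i) * (u \<bullet> i) + (\<Sum>b\<in>Basis - {i}. (v \<bullet> b) * (u \<bullet> b))"
          using i by (intro sum.remove) auto
        also have "(\<Sum>b\<in>Basis - {i}. (v \<bullet> b) * (u \<bullet> b)) = (v \<bullet> j) * (u \<bullet> j) + (\<Sum>b\<in>?J. (v \<bullet> b) * (u \<bullet> b))"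
          using j ij by (intro sum.remove) auto
        finally have "v \<bullet> u = (v \<bullet> i) * (u \<bullet> i) + ((v \<bullet> j) * (u \<bullet> j) + (\<Sum>b\<in>?J. (v \<bullet> b) * (u \<bullet> b)))" .
        moreover have "\<bar>\<Sum>b\<in>?J. (v \<bullet> b) * (u \<bullet> b)\<bar> \<le> \<delta>"
          using v T(2) xy \<delta> by (intro abs_sum_coordinates_le) (auto simp: u_def inner_diff_left)
        ultimately show ?thesis using v(2) by (simp add: algebra_simps)
      qed
      have a: "\<bar>(n \<bullet> i) * (u \<bullet> i) + (n \<bullet> j) * (u \<bullet> j)\<bar> \<le> (2 * C + 1) * \<delta>"
        using near[of x y] xy T(1) n by (intro small) (auto simp: u_def inner_diff_right)
      have b: "\<bar>(m \<bullet> i) * (u \<bullet> i) + (m \<bullet> j) * (u \<bullet> j)\<bar> \<le> (2 * C + 1) * \<delta>"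
        using near'[of x y] xy T(1) m by (intro small) (auto simp: u_def inner_diff_right)
      have "(w \<bullet> j) * (u \<bullet> j) = (n \<bullet> i) * ((m \<bullet> i) * (u \<bullet> i) + (m \<bullet> j) * (u \<bullet> j))
          - (m \<bullet> i) * ((n \<bullet> i) * (u \<bullet> i) + (n \<bullet> j) * (u \<bullet> j))"
        by (simp add: wj algebra_simps)
      also have "\<bar>\<dots>\<bar> \<le> \<bar>n \<bullet> i\<bar> * \<bar>(m \<bullet> i) * (u \<bullet> i) + (m \<bullet> j) * (u \<bullet> j)\<bar>
          + \<bar>m \<bullet> i\<bar> * \<bar>(n \<bullet> i) * (u \<bullet> i) + (n \<bullet> j) * (u \<bullet> j)\<bar>"
        unfolding abs_mult[symmetric] by (rule abs_triangle_ineq4)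
      also have "\<dots> \<le> 1 * ((2 * C + 1) * \<delta>) + 1 * ((2 * C + 1) * \<delta>)"
        using a b Basis_le_norm[OF i(1), of n] Basis_le_norm[OF i(1), of m] n m
        by (intro add_mono mult_mono) auto
      finally have "\<bar>w \<bullet> j\<bar> * \<bar>u \<bullet> j\<bar> \<le> 2 * ((2 * C + 1) * \<delta>)"
        unfolding abs_mult mult_1_left by linarith
      then have *: "?D ^ 2 * (\<bar>w \<bullet> j\<bar> * \<bar>u \<bullet> j\<bar>) \<le> ?D ^ 2 * (2 * ((2 * C + 1) * \<delta>))"
        by (rule mult_left_mono) simp
      have "\<theta> * \<bar>u \<bullet> j\<bar> \<le> ?D ^ 2 * \<bar>w \<bullet> j\<bar> * \<bar>u \<bullet> j\<bar>"
        using w\<theta> by (rule mult_right_mono) simp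
      also have "\<dots> \<le> ?D ^ 2 * (2 * ((2 * C + 1) * \<delta>))"
        using * by (simp only: mult.assoc)
      also have "\<dots> = 2 * (2 * C + 1) * \<delta> * ?D ^ 2" by simp
      finally have "\<theta> * \<bar>u \<bullet> j\<bar> \<le> 2 * (2 * C + 1) * \<delta> * ?D ^ 2" .
      then show "\<bar>x \<bullet> j - y \<bullet> j\<bar> \<le> ?L"
        using \<theta>(2) by (simp add: u_def inner_diff_left pos_le_divide_eq mult.commute)
    next
      fix U assume U: "U \<subseteq> T" "\<forall>x\<in>U. \<forall>y\<in>U. \<bar>x \<bullet> j - y \<bullet> j\<bar> \<le> \<delta> / ?D"
      show "real (card U) \<le> ?A * M"
      proof (rule card_le_near_hyperplane_in_column[OF _ \<delta>(1) C \<open>0 \<le> M\<close> n i])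
        show "finite U" using \<open>finite T\<close> U finite_subset by blast
        show "\<bar>x \<bullet> b - y \<bullet> b\<bar> \<le> \<delta> / ?D" if "b \<in> Basis - {i}" "x \<in> U" "y \<in> U" for b x y
          using T(2) U that by (cases "b = j") (auto simp: subset_iff)
        show "\<bar>n \<bullet> x - n \<bullet> y\<bar> \<le> 2 * C * \<delta>" if "x \<in> U" "y \<in> U" for x y
          using near that T(1) U(1) by blast
        show "real (card V) \<le> M" if "V \<subseteq> U" "V \<subseteq> cball x \<delta>" for V x
          using that T(1) U(1) by (intro M[of V x]) auto
      qed
    qed (use \<open>finite T\<close> \<delta> C \<theta>(2) \<open>0 \<le> M\<close> in auto)
  qed (use \<delta> \<open>0 \<le> M\<close> C S(1) \<theta>(2) in auto)
  also have "card ?J = DIM('a) - 2" using i j ij by (simp add: card_Diff_singleton)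
  also have "(2 / (\<delta> / ?D) + 1) ^ (DIM('a) - 2) * ((?L / (\<delta> / ?D) + 1) * (?A * M))
      \<le> ((2 * ?D + 1) ^ (DIM('a) - 2) / \<delta> ^ (DIM('a) - 2))
        * (((2 * (2 * C + 1) * ?D ^ 3 + 1) / \<theta>) * (?A * M))"
  proof -
    have "?L / (\<delta> / ?D) + 1 = 2 * (2 * C + 1) * ?D ^ 3 / \<theta> + 1"
      using \<delta> by (simp add: power2_eq_square power3_eq_cube)
    \<comment> \<open>The summand 1 is absorbed into the quotient since
      \<open>\<theta> \<le> 1\<close>.\<close>
    also have "\<dots> \<le> (2 * (2 * C + 1) * ?D ^ 3 + 1) / \<theta>"
      using \<theta>(2) \<theta>1 by (simp add: field_simps)
    finally show ?thesis
      using \<delta> C \<theta>(2) \<open>0 \<le> M\<close> by (intro mult_mono box_factor_le mult_right_mono) auto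
  qed
  finally show ?thesis by (simp add: mult_ac)
qed

section \<open>Neighbourhoods of hyperplanes\<close>

text \<open>The functional \<open>n\<close> is 1-Lipschitz and constant on \<open>V\<close>, so the
  difference of its values bounds the distance from \<open>x\<close> to every point of
  \<open>V\<close> from below.\<close>

lemma neighborhood_hyperplane:
  assumes "unit_normal V n" "x \<in> neighborhood V r"
  shows "\<bar>n \<bullet> x - n \<bullet> foot V\<bar> \<le> r"
proof -
  have "foot V \<in> V" using unit_normal_foot(2)[OF assms(1)] by simp
  then have ne: "V \<noteq> {}" by blast
  have "\<bar>n \<bullet> x - n \<bullet> foot V\<bar> \<le> (INF y\<in>V. dist x y)"
  proof (rule cINF_greatest[OF ne])
    fix y assume "y \<in> V"
    then have "n \<bullet> x - n \<bullet> foot V = n \<bullet> (x - y)"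
      using unit_normal_foot(2)[OF assms(1)] by (simp add: inner_diff_right)
    also have "\<bar>\<dots>\<bar> \<le> norm n * norm (x - y)" by (rule Cauchy_Schwarz_ineq2)
    finally show "\<bar>n \<bullet> x - n \<bullet> foot V\<bar> \<le> dist x y"
      using assms(1) by (simp add: unit_normal_def dist_norm)
  qed
  then show ?thesis using assms(2) ne by (simp add: neighborhood_def infdist_def)
qed

lemma neighborhood_hyperplane_diff:
  assumes "unit_normal V n" "x \<in> neighborhood V (C * \<delta>)" "y \<in> neighborhood V (C * \<delta>)"
  shows "\<bar>n \<bullet> x - n \<bullet> y\<bar> \<le> 2 * C * \<delta>"
  using neighborhood_hyperplane[OF assms(1,2)] neighborhood_hyperplane[OF assms(1,3)] by linarith

text \<open>The constant is chosen before \<open>\<delta>\<close>, \<open>M\<close>,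
  \<open>V\<close> and \<open>S\<close>: it depends on \<open>C\<close> and the dimension
  only.\<close>

lemma card_neighborhood_hyperplane:
  assumes "0 \<le> C"
  shows "\<exists>K>0. \<forall>\<delta> M V (S::'a::euclidean_space set). 0 < \<delta> \<longrightarrow> \<delta> < 1 \<longrightarrow> 0 \<le> M \<longrightarrow> V \<in> hyperplanes \<longrightarrow>
    finite S \<longrightarrow> S \<subseteq> cball 0 1 \<inter> neighborhood V (C * \<delta>) \<longrightarrow>
    (\<forall>U x. U \<subseteq> S \<longrightarrow> U \<subseteq> cball x \<delta> \<longrightarrow> real (card U) \<le> M) \<longrightarrow>
    real (card S) \<le> K * M / \<delta> ^ (DIM('a) - 1)"
proof (intro exI conjI allI impI)
  let ?K = "(2 * real DIM('a) + 1) ^ (DIM('a) - 1) * ((2 * C + 1) * real DIM('a) ^ 2 + 1)"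
  show "0 < ?K" using assms by (intro mult_pos_pos add_nonneg_pos) auto
  fix \<delta> M V and S :: "'a set"
  assume a: "0 < \<delta>" "\<delta> < 1" "0 \<le> M" "V \<in> hyperplanes" "finite S"
    "S \<subseteq> cball 0 1 \<inter> neighborhood V (C * \<delta>)"
    "\<forall>U x. U \<subseteq> S \<longrightarrow> U \<subseteq> cball x \<delta> \<longrightarrow> real (card U) \<le> M"
  obtain n where n: "unit_normal V n" using unit_normal_exists a(4) by blast
  show "real (card S) \<le> ?K * M / \<delta> ^ (DIM('a) - 1)"
  proof (rule card_le_near_hyperplane[OF a(5) _ a(1,2) assms a(3)])
    show "S \<subseteq> cball 0 1" using a(6) by blast
    show "norm n = 1" using n by (simp add: unit_normal_def)
    show "\<bar>n \<bullet> x - n \<bullet> y\<bar> \<le> 2 * C * \<delta>" if "x \<in> S" "y \<in> S" for x y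
      using that a(6) by (intro neighborhood_hyperplane_diff[OF n]) auto
    show "real (card U) \<le> M" if "U \<subseteq> S" "U \<subseteq> cball x \<delta>" for U x
      using that a(7) by blast
  qed
qed

text \<open>A common nearby point of the unit ball ties the heights
  \<open>n \<bullet> foot V\<close> and \<open>m \<bullet> foot W\<close> together up to
  \<open>2 * r + norm (n - m)\<close>, so the feet differ by at most
  \<open>2 * r + 2 * norm (n - m)\<close>. The operator part adds another
  \<open>2 * norm (n - m)\<close>, and each \<open>norm (n - m)\<close> is at most twice the
  sine.\<close>

lemma dist_hyp_le_angle:
  fixes V W :: "'a::euclidean_space set"
  assumes n: "unit_normal V n" and m: "unit_normal W m"
    and W: "W \<inter> cball 0 1 \<noteq> {}" and nm: "0 \<le> n \<bullet> m"
    and x: "norm x \<le> 1" "x \<in> neighborhood V r" "x \<in> neighborhood W r"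
  shows "dist_hyp V W \<le> 8 * sqrt (1 - (n \<bullet> m)\<^sup>2) + 2 * r"
proof -
  let ?c = "n \<bullet> foot V" and ?c' = "m \<bullet> foot W"
  have nn: "norm n = 1" "norm m = 1" and Wh: "W \<in> hyperplanes" using n m by (auto simp: unit_normal_def)
  have "\<bar>(n - m) \<bullet> x\<bar> \<le> norm (n - m) * norm x" by (rule Cauchy_Schwarz_ineq2)
  also have "\<dots> \<le> norm (n - m)" using x by (simp add: mult_left_le)
  finally have "\<bar>?c - ?c'\<bar> \<le> 2 * r + norm (n - m)"
    using neighborhood_hyperplane[OF n x(2)] neighborhood_hyperplane[OF m x(3)]
    by (simp add: inner_diff_left)
  moreover have "norm (foot V - foot W) \<le> \<bar>?c - ?c'\<bar> + norm (n - m)"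
  proof -
    have "foot V - foot W = ?c *\<^sub>R n - ?c' *\<^sub>R m"
      using unit_normal_foot(1)[OF n] unit_normal_foot(1)[OF m] by simp
    also have "\<dots> = (?c - ?c') *\<^sub>R n + ?c' *\<^sub>R (n - m)" by (simp add: algebra_simps)
    also have "norm \<dots> \<le> \<bar>?c - ?c'\<bar> * norm n + \<bar>?c'\<bar> * norm (n - m)"
      by (metis norm_scaleR norm_triangle_ineq)
    also have "\<dots> \<le> \<bar>?c - ?c'\<bar> * 1 + 1 * norm (n - m)"
      using nn Cauchy_Schwarz_ineq2[of m "foot W"] foot_norm_le_1[OF Wh W]
      by (intro add_mono mult_mono) auto
    finally show ?thesis by simp
  qed
  moreover have "dist_hyp V W \<le> 2 * norm (n - m) + norm (foot V - foot W)"
    using dist_hyp_normals[OF n m] onorm_normals_le[OF nn] by simp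
  ultimately show ?thesis using norm_diff_le_sin[OF nn nm] by linarith
qed

text \<open>Replaces the sine of the angle by the distance of the hyperplanes, the quantity that the
  separation and non-concentration of the hyperplanes control.\<close>

lemma card_neighborhood_two_hyperplanes:
  assumes C: "0 \<le> C" and D: "2 \<le> DIM('a)"
  shows "\<exists>K>0. \<forall>\<delta> M V W (S::'a::euclidean_space set). 0 < \<delta> \<longrightarrow> \<delta> < 1 \<longrightarrow> 0 \<le> M \<longrightarrow>
    V \<in> hyperplanes \<longrightarrow> W \<in> hyperplanes \<longrightarrow> W \<inter> cball 0 1 \<noteq> {} \<longrightarrow> 0 < dist_hyp V W \<longrightarrow>
    finite S \<longrightarrow> S \<subseteq> cball 0 1 \<inter> (neighborhood V (C * \<delta>) \<inter> neighborhood W (C * \<delta>)) \<longrightarrow>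
    (\<forall>U x. U \<subseteq> S \<longrightarrow> U \<subseteq> cball x \<delta> \<longrightarrow> real (card U) \<le> M) \<longrightarrow>
    real (card S) \<le> K * M / (\<delta> ^ (DIM('a) - 2) * dist_hyp V W)"
proof -
  obtain K1 where K1: "K1 > 0" "\<forall>\<delta> M V (S::'a set). 0 < \<delta> \<longrightarrow> \<delta> < 1 \<longrightarrow> 0 \<le> M \<longrightarrow> V \<in> hyperplanes \<longrightarrow>
    finite S \<longrightarrow> S \<subseteq> cball 0 1 \<inter> neighborhood V (C * \<delta>) \<longrightarrow>
    (\<forall>U x. U \<subseteq> S \<longrightarrow> U \<subseteq> cball x \<delta> \<longrightarrow> real (card U) \<le> M) \<longrightarrow>
    real (card S) \<le> K1 * M / \<delta> ^ (DIM('a) - 1)"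
    using card_neighborhood_hyperplane[OF C, where 'a='a] by (elim exE conjE)
  define K2 where "K2 = (2 * real DIM('a) + 1) ^ (DIM('a) - 2) *
      ((2 * (2 * C + 1) * real DIM('a) ^ 3 + 1) * ((2 * C + 1) * real DIM('a) ^ 2 + 1))"
  have K2: "K2 > 0" unfolding K2_def using C by (intro mult_pos_pos add_nonneg_pos) auto
  show ?thesis
  proof (intro exI conjI allI impI)
    let ?K = "(K1 + K2) * (8 + 2 * C)"
    show "0 < ?K" using K1(1) K2 C by (intro mult_pos_pos) auto
    fix \<delta> M V W and S :: "'a set"
    assume a: "0 < \<delta>" "\<delta> < 1" "0 \<le> M" "V \<in> hyperplanes" "W \<in> hyperplanes" "W \<inter> cball 0 1 \<noteq> {}"
      "0 < dist_hyp V W" "finite S"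
      "S \<subseteq> cball 0 1 \<inter> (neighborhood V (C * \<delta>) \<inter> neighborhood W (C * \<delta>))"
      "\<forall>U x. U \<subseteq> S \<longrightarrow> U \<subseteq> cball x \<delta> \<longrightarrow> real (card U) \<le> M"
    let ?r = "dist_hyp V W" and ?q = "\<delta> ^ (DIM('a) - 2)"
    have q: "0 < ?q" using a(1) by simp
    show "real (card S) \<le> ?K * M / (?q * ?r)"
    proof (cases "S = {}")
      case True
      then show ?thesis using K1(1) K2 C a(1,3,7) by simp
    next
      case False
      then obtain x where x: "x \<in> S" by blast
      obtain n where n: "unit_normal V n" using unit_normal_exists a(4) by blast
      obtain m' where m': "unit_normal W m'" using unit_normal_exists a(5) by blast
      \<comment> \<open>Reversing the normal of \<open>W\<close> if necessary makes the angle at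
        most a right angle, as the comparison of distance and sine requires.\<close>
      define m where "m = (if 0 \<le> n \<bullet> m' then m' else - m')"
      have m: "unit_normal W m" and nm: "0 \<le> n \<bullet> m"
        using m' unit_normal_minus by (auto simp: m_def)
      have nn: "norm n = 1" "norm m = 1" using n m by (auto simp: unit_normal_def)
      define \<theta> where "\<theta> = sqrt (1 - (n \<bullet> m)\<^sup>2)"
      have r: "?r \<le> 8 * \<theta> + 2 * (C * \<delta>)"
        unfolding \<theta>_def using x a(9) by (intro dist_hyp_le_angle[OF n m a(6) nm]) auto
      \<comment> \<open>If the sine is at least \<open>\<delta>\<close>, it dominates the distance
        and the count near two hyperplanes applies. Otherwise the distance is
        \<open>O(\<delta>)\<close>, and the count near \<open>V\<close> alone, with one more factor
        \<open>1 / \<delta>\<close>, is already good enough.\<close>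
      show ?thesis
      proof (cases "\<delta> \<le> \<theta>")
        case True
        have "C * \<delta> \<le> C * \<theta>" using True C by (rule mult_left_mono)
        then have r: "?r \<le> (8 + 2 * C) * \<theta>" using r by (simp add: algebra_simps)
        have "real (card S) \<le> K2 * M / (?q * \<theta>)"
          unfolding K2_def
        proof (rule card_le_near_two_hyperplanes[OF a(8) _ a(1,2) C a(3) nn \<theta>_def])
          show "0 < \<theta>" using True a(1) by simp
          show "S \<subseteq> cball 0 1" using a(9) by blast
          show "\<bar>n \<bullet> x - n \<bullet> y\<bar> \<le> 2 * C * \<delta>" if "x \<in> S" "y \<in> S" for x y
            using that a(9) by (intro neighborhood_hyperplane_diff[OF n]) auto
          show "\<bar>m \<bullet> x - m \<bullet> y\<bar> \<le> 2 * C * \<delta>" if "x \<in> S" "y \<in> S" for x y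
            using that a(9) by (intro neighborhood_hyperplane_diff[OF m]) auto
          show "real (card U) \<le> M" if "U \<subseteq> S" "U \<subseteq> cball x \<delta>" for U x
            using that a(10) by blast
        qed
        also have "\<dots> \<le> (K1 + K2) * M / (?q * \<theta>)"
          using K1(1) K2 a(1,3) True by (intro divide_right_mono mult_right_mono) auto
        also have "\<dots> = ((K1 + K2) * M / ?q) * (1 / \<theta>)" by simp
        also have "\<dots> \<le> ((K1 + K2) * M / ?q) * ((8 + 2 * C) / ?r)"
          using r K1(1) K2 a(1,3,7) True by (intro mult_left_mono) (auto simp: field_simps)
        finally show ?thesis by (simp add: mult_ac)
      next
        case False
        have r: "?r \<le> (8 + 2 * C) * \<delta>" using r False by (simp add: algebra_simps)
        have "real (card S) \<le> K1 * M / \<delta> ^ (DIM('a) - 1)"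
          using K1(2)[rule_format, of \<delta> M V S] a by blast
        also have "\<delta> ^ (DIM('a) - 1) = ?q * \<delta>"
          using D by (metis Suc_1 Suc_diff_Suc Suc_le_lessD power_Suc2)
        also have "K1 * M / (?q * \<delta>) \<le> (K1 + K2) * M / (?q * \<delta>)"
          using K1(1) K2 a(1,3) by (intro divide_right_mono mult_right_mono) auto
        also have "\<dots> = ((K1 + K2) * M / ?q) * (1 / \<delta>)" by simp
        also have "\<dots> \<le> ((K1 + K2) * M / ?q) * ((8 + 2 * C) / ?r)"
          using r K1(1) K2 a(1,3,7) by (intro mult_left_mono) (auto simp: field_simps)
        finally show ?thesis by (simp add: mult_ac)
      qed
    qed
  qed
qed

section \<open>The Cauchy--Schwarz argument\<close>

text \<open>Cauchy-Schwarz against the constant 1 on \<open>P\<close>, applied to the number of sets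
  \<open>A h\<close> containing a point. Expanding the square of that number produces the pairwise
  intersections.\<close>

lemma sum_card_square_le:
  assumes "finite P" "finite H" "\<And>h. h \<in> H \<Longrightarrow> A h \<subseteq> P"
  shows "(real (\<Sum>h\<in>H. card (A h)))\<^sup>2 \<le> real (card P) * (\<Sum>g\<in>H. \<Sum>h\<in>H. real (card (A g \<inter> A h)))"
proof -
  define e where "e h p = (if p \<in> A h then 1 else 0 :: real)" for h p
  have A: "real (card (A h)) = (\<Sum>p\<in>P. e h p)" if "h \<in> H" for h
  proof -
    have "P \<inter> A h = A h" using assms(3)[OF that] by blast
    then show ?thesis using assms(1) by (simp add: e_def sum.If_cases)
  qed
  have AA: "real (card (A g \<inter> A h)) = (\<Sum>p\<in>P. e g p * e h p)" if "g \<in> H" "h \<in> H" for g h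
  proof -
    have "P \<inter> {p. p \<in> A g \<inter> A h} = A g \<inter> A h" using assms(3)[OF that(1)] by blast
    moreover have "e g p * e h p = (if p \<in> A g \<inter> A h then 1 else 0)" for p by (simp add: e_def)
    ultimately show ?thesis using assms(1) by (simp only: sum.If_cases) (simp del: Int_iff)
  qed
  have "(real (\<Sum>h\<in>H. card (A h)))\<^sup>2 = (\<Sum>p\<in>P. 1 * (\<Sum>h\<in>H. e h p))\<^sup>2"
    using A by (simp add: sum.swap[of _ P H])
  also have "\<dots> \<le> (\<Sum>p\<in>P. 1\<^sup>2) * (\<Sum>p\<in>P. (\<Sum>h\<in>H. e h p)\<^sup>2)"
    by (rule Cauchy_Schwarz_ineq_sum)
  also have "(\<Sum>p\<in>P. (\<Sum>h\<in>H. e h p)\<^sup>2) = (\<Sum>p\<in>P. \<Sum>g\<in>H. \<Sum>h\<in>H. e g p * e h p)"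
    by (simp add: power2_eq_square sum_product)
  also have "\<dots> = (\<Sum>g\<in>H. \<Sum>h\<in>H. \<Sum>p\<in>P. e g p * e h p)"
    by (subst sum.swap) (intro sum.cong refl sum.swap)
  also have "\<dots> = (\<Sum>g\<in>H. \<Sum>h\<in>H. real (card (A g \<inter> A h)))"
    using AA by simp
  finally show ?thesis by simp
qed

text \<open>The shell between \<open>2 ^ k * r\<close> and \<open>2 ^ Suc k * r\<close> contributes
  at most its counting bound divided by \<open>2 ^ k * r\<close>. As \<open>t \<le> 1\<close>, the
  power \<open>(2 ^ Suc k) powr t\<close> is at most \<open>2 ^ Suc k\<close>, so every shell has
  the same bound and only the number of shells remains.\<close>

lemma sum_inverse_distance_le:
  fixes \<rho> :: "'h \<Rightarrow> real"
  assumes H: "finite H" and r: "0 < r" and t: "t \<le> 1" and B: "0 \<le> B"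
    and count: "\<And>u. r \<le> u \<Longrightarrow> real (card {h \<in> H. \<rho> h \<le> u}) \<le> B * u powr t * real (card H)"
  shows "(\<Sum>h | h \<in> H \<and> r < \<rho> h \<and> \<rho> h \<le> 2 ^ k * r. 1 / \<rho> h)
    \<le> real k * (2 * B * r powr (t - 1) * real (card H))"
proof (induction k)
  case 0
  have "{h \<in> H. r < \<rho> h \<and> \<rho> h \<le> 2 ^ 0 * r} = {}" by auto
  then show ?case by (simp only: sum.empty)
next
  case (Suc k)
  let ?u = "2 ^ Suc k * r"
  let ?X = "{h. h \<in> H \<and> r < \<rho> h \<and> \<rho> h \<le> 2 ^ k * r}" and ?Y = "{h \<in> H. 2 ^ k * r < \<rho> h \<and> \<rho> h \<le> ?u}"
  have rk: "r \<le> 2 ^ k * r" "r \<le> ?u" using r by (simp_all add: mult_le_cancel_right1 del: power_Suc)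
  have "{h. h \<in> H \<and> r < \<rho> h \<and> \<rho> h \<le> ?u} \<subseteq> ?X \<union> ?Y" by auto
  then have "(\<Sum>h | h \<in> H \<and> r < \<rho> h \<and> \<rho> h \<le> ?u. 1 / \<rho> h) \<le> (\<Sum>h\<in>?X \<union> ?Y. 1 / \<rho> h)"
    using H r rk by (intro sum_mono2) auto
  also have "\<dots> = (\<Sum>h\<in>?X. 1 / \<rho> h) + (\<Sum>h\<in>?Y. 1 / \<rho> h)"
    using H by (intro sum.union_disjoint) auto
  also have "(\<Sum>h\<in>?Y. 1 / \<rho> h) \<le> (\<Sum>h\<in>?Y. 1 / (2 ^ k * r))"
    using r by (intro sum_mono divide_left_mono) (auto intro!: mult_pos_pos less_trans[of 0 "2 ^ k * r"])
  also have "\<dots> = real (card ?Y) * (1 / (2 ^ k * r))" by simp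
  also have "\<dots> \<le> (B * (2 ^ Suc k * r powr t) * real (card H)) * (1 / (2 ^ k * r))"
  proof (rule mult_right_mono)
    have "real (card ?Y) \<le> real (card {h \<in> H. \<rho> h \<le> ?u})"
      using H by (intro of_nat_mono card_mono) auto
    also have "\<dots> \<le> B * ?u powr t * real (card H)" by (rule count[OF rk(2)])
    also have "\<dots> \<le> B * (2 ^ Suc k * r powr t) * real (card H)"
    proof -
      have "((2::real) ^ Suc k) powr t \<le> (2 ^ Suc k) powr 1"
        using t by (intro powr_mono one_le_power) auto
      then have "?u powr t \<le> 2 ^ Suc k * r powr t"
        using r by (simp add: powr_mult mult_right_mono del: power_Suc)
      then show ?thesis using B by (intro mult_right_mono mult_left_mono) auto
    qed
    finally show "real (card ?Y) \<le> B * (2 ^ Suc k * r powr t) * real (card H)" .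
  qed (use r in simp)
  also have "\<dots> = 2 * B * r powr (t - 1) * real (card H)"
    using r by (simp add: powr_diff)
  finally show ?case using Suc.IH by (simp add: algebra_simps)
qed

text \<open>Near pairs are bounded by \<open>card (A g)\<close>, which brings the incidence count
  back on the right. Far pairs are summed over dyadic shells; the assumption \<open>diam\<close>
  ensures that \<open>k\<close> shells reach all of them.\<close>

lemma sum_card_square_le_by_distance:
  fixes \<rho> :: "'h \<Rightarrow> 'h \<Rightarrow> real"
  assumes fin: "finite P" "finite H" and A: "\<And>h. h \<in> H \<Longrightarrow> A h \<subseteq> P"
    and r: "0 < r" and t: "t \<le> 1" and B: "0 \<le> B" and Q: "0 \<le> Q"
    and count: "\<And>g u. g \<in> H \<Longrightarrow> r \<le> u \<Longrightarrow> real (card {h \<in> H. \<rho> g h \<le> u}) \<le> B * u powr t * real (card H)"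
    and pair: "\<And>g h. g \<in> H \<Longrightarrow> h \<in> H \<Longrightarrow> r < \<rho> g h \<Longrightarrow> real (card (A g \<inter> A h)) \<le> Q / \<rho> g h"
    and diam: "\<And>g h. g \<in> H \<Longrightarrow> h \<in> H \<Longrightarrow> \<rho> g h \<le> 2 ^ k * r"
  shows "(real (\<Sum>h\<in>H. card (A h)))\<^sup>2 \<le> real (card P) *
    (real (\<Sum>h\<in>H. card (A h)) * (B * r powr t * real (card H)) +
     real (card H) * (Q * (real k * (2 * B * r powr (t - 1) * real (card H)))))"
proof -
  have "(\<Sum>h\<in>H. real (card (A g \<inter> A h))) \<le> real (card (A g)) * (B * r powr t * real (card H)) +
      Q * (real k * (2 * B * r powr (t - 1) * real (card H)))" (is "_ \<le> ?E g") if g: "g \<in> H" for g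
  proof -
    let ?X = "{h \<in> H. \<rho> g h \<le> r}" and ?Y = "{h. h \<in> H \<and> r < \<rho> g h \<and> \<rho> g h \<le> 2 ^ k * r}"
    have "H = ?X \<union> ?Y" using diam[OF g] by force
    then have "(\<Sum>h\<in>H. real (card (A g \<inter> A h))) = (\<Sum>h\<in>?X \<union> ?Y. real (card (A g \<inter> A h)))" by simp
    also have "\<dots> = (\<Sum>h\<in>?X. real (card (A g \<inter> A h))) + (\<Sum>h\<in>?Y. real (card (A g \<inter> A h)))"
      using fin by (intro sum.union_disjoint) auto
    also have "(\<Sum>h\<in>?X. real (card (A g \<inter> A h))) \<le> (\<Sum>h\<in>?X. real (card (A g)))"
      using finite_subset[OF A[OF g] fin(1)] by (intro sum_mono of_nat_mono card_mono) auto
    also have "\<dots> = real (card (A g)) * real (card ?X)" by simp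
    also have "\<dots> \<le> real (card (A g)) * (B * r powr t * real (card H))"
      using count[OF g order_refl] by (rule mult_left_mono) simp
    also have "(\<Sum>h\<in>?Y. real (card (A g \<inter> A h))) \<le> (\<Sum>h\<in>?Y. Q * (1 / \<rho> g h))"
      using pair[OF g] by (intro sum_mono) auto
    also have "\<dots> = Q * (\<Sum>h\<in>?Y. 1 / \<rho> g h)" by (simp only: sum_distrib_left)
    also have "\<dots> \<le> Q * (real k * (2 * B * r powr (t - 1) * real (card H)))"
      using count[OF g] by (intro mult_left_mono[OF _ Q] sum_inverse_distance_le[OF fin(2) r t B]) auto
    finally show ?thesis by simp
  qed
  then have "(\<Sum>g\<in>H. \<Sum>h\<in>H. real (card (A g \<inter> A h))) \<le> (\<Sum>g\<in>H. ?E g)" by (rule sum_mono)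
  also have "\<dots> = real (\<Sum>h\<in>H. card (A h)) * (B * r powr t * real (card H)) +
     real (card H) * (Q * (real k * (2 * B * r powr (t - 1) * real (card H))))"
    by (simp add: sum.distrib sum_distrib_right)
  finally show ?thesis
    using sum_card_square_le[OF fin A] by (meson mult_left_mono of_nat_0_le_iff order_trans)
qed

text \<open>Removes \<open>I\<close> from the right side: if \<open>I\<close> exceeded the bound,
  then \<open>Y < I\<close>, the right side would be at most \<open>(b + c) * Y * I\<close>, and
  this is less than \<open>I\<^sup>2\<close>.\<close>

lemma le_of_quadratic_inequality:
  fixes I Y b c :: real
  assumes "0 \<le> Y" "0 \<le> b" "0 \<le> c" "I\<^sup>2 \<le> b * Y * I + c * Y\<^sup>2"
  shows "I \<le> (b + c + 1) * Y"
proof (rule ccontr)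
  assume "\<not> ?thesis"
  then have I: "(b + c + 1) * Y < I" by simp
  have "0 \<le> (b + c) * Y" using assms by simp
  then have YI: "Y < I" "0 < I" using I assms(1) by (simp_all add: algebra_simps)
  have "(b + c + 1) * Y * I < I * I" using I YI(2) by (rule mult_strict_right_mono)
  moreover have "c * Y * Y \<le> c * Y * I" "0 \<le> Y * I" using YI assms by (auto intro: mult_left_mono)
  ultimately show False using assms(4) by (simp add: power2_eq_square algebra_simps)
qed

lemma incidences_eq_sum:
  assumes "finite P" "finite H"
  shows "incidences r P H = (\<Sum>\<pi>\<in>H. card (P \<inter> neighborhood \<pi> r))"
proof -
  have "{(p, \<pi>). p \<in> P \<and> \<pi> \<in> H \<and> p \<in> neighborhood \<pi> r}
      = prod.swap ` (SIGMA \<pi>:H. P \<inter> neighborhood \<pi> r)" by force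
  then have "incidences r P H = card (SIGMA \<pi>:H. P \<inter> neighborhood \<pi> r)"
    unfolding incidences_def by (simp add: card_image)
  then show ?thesis using assms by simp
qed

text \<open>Counts the dyadic scales between \<open>\<delta>\<close> and 8, the bound used for
  distances of hyperplanes. Here \<open>log 2 8 = 3\<close> and rounding up give the 4, while
  \<open>1 / ln 2 \<le> 2\<close> and \<open>ln x \<le> x powr \<epsilon> / \<epsilon>\<close> turn
  the logarithm into the term with \<open>2 / \<epsilon>\<close>.\<close>

lemma dyadic_steps:
  fixes \<delta> \<epsilon> :: real
  assumes "0 < \<delta>" "\<delta> < 1" "0 < \<epsilon>"
  shows "\<exists>k::nat. 8 / \<delta> \<le> 2 ^ k \<and> real k \<le> (4 + 2 / \<epsilon>) * \<delta> powr (- \<epsilon>)"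
proof (intro exI conjI)
  let ?L = "log 2 (8 / \<delta>)"
  let ?k = "nat \<lceil>?L\<rceil>"
  have one: "1 \<le> 8 / \<delta>" using assms by (simp add: field_simps)
  have "8 / \<delta> = 2 powr ?L" using assms by simp
  also have "\<dots> \<le> 2 powr real ?k" by (intro powr_mono real_nat_ceiling_ge) auto
  finally show "8 / \<delta> \<le> 2 ^ ?k" by (simp add: powr_realpow)
  have "log 2 (8::real) = 3"
    using log_pow_cancel[of "2::real" 3] by simp
  then have L: "?L = 3 + ln (1 / \<delta>) / ln 2"
    using assms log_divide[of "2::real" 8 \<delta>] by (simp add: log_def ln_div)
  have pos: "0 \<le> ln (1 / \<delta>)" using assms by (simp add: ln_div)
  have "ln (1 / \<delta>) / ln 2 \<le> ln (1 / \<delta>) / (1 / 2)"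
    using pos ln2_ge_two_thirds by (intro divide_left_mono) auto
  moreover have "ln (1 / \<delta>) \<le> (1 / \<delta>) powr \<epsilon> / \<epsilon>"
    using assms by (intro ln_powr_bound) (auto simp: field_simps)
  moreover have "(1 / \<delta>) powr \<epsilon> = \<delta> powr (- \<epsilon>)"
    using assms by (simp add: powr_divide powr_minus_divide)
  ultimately have "ln (1 / \<delta>) / ln 2 \<le> 2 * (\<delta> powr (- \<epsilon>) / \<epsilon>)" by simp
  moreover have "real ?k \<le> ?L + 1"
    using zero_le_log_cancel_iff[of 2 "8 / \<delta>"] one by linarith
  ultimately have "real ?k \<le> 4 + 2 * (\<delta> powr (- \<epsilon>) / \<epsilon>)" using L by linarith
  moreover have "1 \<le> \<delta> powr (- \<epsilon>)" using assms by (simp add: powr_minus one_le_inverse_iff powr_le1)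
  ultimately have "real ?k \<le> 4 * \<delta> powr (- \<epsilon>) + 2 * (\<delta> powr (- \<epsilon>) / \<epsilon>)" by linarith
  then show "real ?k \<le> (4 + 2 / \<epsilon>) * \<delta> powr (- \<epsilon>)" by (simp add: algebra_simps)
qed

text \<open>Pairs of hyperplanes closer than \<open>\<delta> powr (\<sigma> / (1 + t))\<close> are estimated trivially; this
  threshold balances their contribution with that of the remaining pairs. If it is below \<open>\<delta>\<close>, where
  the count of nearby hyperplanes is no longer available, the bound for a single hyperplane
  is strong enough.\<close>

lemma incidence_bound_of_counts:
  fixes A :: "'h \<Rightarrow> 'p set" and \<rho> :: "'h \<Rightarrow> 'h \<Rightarrow> real"
  assumes fin: "finite P" "finite H" and A: "\<And>h. h \<in> H \<Longrightarrow> A h \<subseteq> P"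
    and \<delta>: "0 < \<delta>" "\<delta> < 1" and t: "0 \<le> t" "t \<le> 1" and a: "0 \<le> a" and B: "0 \<le> B" and \<epsilon>: "0 < \<epsilon>"
    and single: "\<And>h. h \<in> H \<Longrightarrow> real (card (A h)) \<le> a * real (card P) * \<delta> powr (\<sigma> - 1)"
    and pair: "\<And>g h. g \<in> H \<Longrightarrow> h \<in> H \<Longrightarrow> 0 < \<rho> g h \<Longrightarrow>
      real (card (A g \<inter> A h)) \<le> a * real (card P) * \<delta> powr \<sigma> / \<rho> g h"
    and count: "\<And>g u. g \<in> H \<Longrightarrow> \<delta> \<le> u \<Longrightarrow> real (card {h \<in> H. \<rho> g h \<le> u}) \<le> B * u powr t * real (card H)"
    and diam: "\<And>g h. g \<in> H \<Longrightarrow> h \<in> H \<Longrightarrow> \<rho> g h \<le> 8"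
  shows "real (\<Sum>h\<in>H. card (A h)) \<le> (a + B + 2 * a * B * (4 + 2 / \<epsilon>) + 1) *
    (real (card P) * real (card H)) * \<delta> powr (t / (1 + t) * \<sigma> - \<epsilon>)"
proof -
  define q where "q = \<sigma> / (1 + t)"
  have "\<sigma> = q * (1 + t)" using t by (simp add: q_def)
  then have \<sigma>: "\<sigma> = q * t + q" by (simp add: algebra_simps)
  have qt: "t / (1 + t) * \<sigma> = q * t" by (simp add: q_def)
  let ?I = "real (\<Sum>h\<in>H. card (A h))" and ?X = "real (card P) * real (card H)"
  let ?K = "a + B + 2 * a * B * (4 + 2 / \<epsilon>) + 1"
  have cc: "0 \<le> 2 * a * B * (4 + 2 / \<epsilon>)" using a B \<epsilon> by simp
  have split: "\<delta> powr (q * t - \<epsilon>) = \<delta> powr (q * t) * \<delta> powr (- \<epsilon>)"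
    by (simp flip: powr_add)
  have e1: "1 \<le> \<delta> powr (- \<epsilon>)" using \<delta> \<epsilon> by (simp add: powr_minus one_le_inverse_iff powr_le1)
  show ?thesis
  proof (cases "q \<le> 1")
    case False
    have "?I = (\<Sum>h\<in>H. real (card (A h)))" by simp
    also have "\<dots> \<le> (\<Sum>h\<in>H. a * real (card P) * \<delta> powr (\<sigma> - 1))" by (rule sum_mono[OF single])
    also have "\<dots> = a * ?X * \<delta> powr (\<sigma> - 1)" by simp
    \<comment> \<open>Since \<open>\<sigma> - 1 = q * t + (q - 1)\<close> and \<open>q > 1\<close>,
      the exponent on the left is the larger one, and \<open>\<delta> < 1\<close>.\<close>
    also have "\<dots> \<le> ?K * ?X * \<delta> powr (q * t - \<epsilon>)"
      using False \<delta> a B cc \<epsilon> by (intro mult_mono powr_mono') (auto simp: \<sigma>)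
    finally show ?thesis by (simp only: qt)
  next
    case True
    define r where "r = \<delta> powr q"
    have r: "0 < r" "\<delta> \<le> r"
      using \<delta> True powr_mono'[of q 1 \<delta>] by (auto simp: r_def)
    obtain k :: nat where k: "8 / \<delta> \<le> 2 ^ k" "real k \<le> (4 + 2 / \<epsilon>) * \<delta> powr (- \<epsilon>)"
      using dyadic_steps[OF \<delta> \<epsilon>] by blast
    have "8 \<le> 2 ^ k * \<delta>" using k(1) \<delta> by (simp add: field_simps)
    also have "\<dots> \<le> 2 ^ k * r" using r by simp
    finally have kr: "8 \<le> 2 ^ k * r" .
    let ?Y = "?X * \<delta> powr (q * t)"
    have "?I\<^sup>2 \<le> real (card P) * (?I * (B * r powr t * real (card H)) +
       real (card H) * ((a * real (card P) * \<delta> powr \<sigma>) * (real k * (2 * B * r powr (t - 1) * real (card H)))))"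
    proof (rule sum_card_square_le_by_distance[OF fin A r(1) t(2) B, where \<rho> = \<rho>])
      show "0 \<le> a * real (card P) * \<delta> powr \<sigma>" using a by simp
      show "real (card {h \<in> H. \<rho> g h \<le> u}) \<le> B * u powr t * real (card H)" if "g \<in> H" "r \<le> u" for g u
        using count that r by simp
      show "real (card (A g \<inter> A h)) \<le> a * real (card P) * \<delta> powr \<sigma> / \<rho> g h"
        if "g \<in> H" "h \<in> H" "r < \<rho> g h" for g h
        using pair that r by simp
      show "\<rho> g h \<le> 2 ^ k * r" if "g \<in> H" "h \<in> H" for g h
        using diam that kr by (meson order_trans)
    qed
    also have "\<dots> = B * (?X * r powr t) * ?I + 2 * a * B * real k * (?X\<^sup>2 * (\<delta> powr \<sigma> * r powr (t - 1)))"
      by (simp add: power2_eq_square algebra_simps)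
    also have "r powr t = \<delta> powr (q * t)" by (simp add: r_def powr_powr)
    \<comment> \<open>This is the balance behind the choice of \<open>q\<close>: from
      \<open>\<sigma> = q * t + q\<close> the exponent \<open>\<sigma> + q * (t - 1)\<close> equals
      \<open>2 * q * t\<close>, so both terms are expressed by the same \<open>?Y\<close>.\<close>
    also have "\<delta> powr \<sigma> * r powr (t - 1) = (\<delta> powr (q * t))\<^sup>2"
      by (simp add: r_def powr_powr power2_eq_square \<sigma> algebra_simps flip: powr_add)
    also have "?X\<^sup>2 * (\<delta> powr (q * t))\<^sup>2 = ?Y\<^sup>2" by (simp only: power_mult_distrib)
    finally have "?I \<le> (B + 2 * a * B * real k + 1) * ?Y"
      using a B by (intro le_of_quadratic_inequality) auto
    also have "\<dots> \<le> (?K * \<delta> powr (- \<epsilon>)) * ?Y"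
    proof (rule mult_right_mono)
      have "2 * a * B * real k \<le> 2 * a * B * ((4 + 2 / \<epsilon>) * \<delta> powr (- \<epsilon>))"
        using k(2) a B by (intro mult_left_mono) auto
      moreover have "(a + B + 1) * 1 \<le> (a + B + 1) * \<delta> powr (- \<epsilon>)"
        using e1 a B by (intro mult_left_mono) auto
      then have "B + 1 \<le> (a + B + 1) * \<delta> powr (- \<epsilon>)" using a by (auto elim: order_trans[rotated])
      ultimately have "(B + 1) + 2 * a * B * real k
          \<le> (a + B + 1) * \<delta> powr (- \<epsilon>) + 2 * a * B * ((4 + 2 / \<epsilon>) * \<delta> powr (- \<epsilon>))"
        by (intro add_mono)
      also have "\<dots> = ?K * \<delta> powr (- \<epsilon>)" by (simp only: distrib_right mult.assoc add_ac)
      finally show "B + 2 * a * B * real k + 1 \<le> ?K * \<delta> powr (- \<epsilon>)" by (simp only: add_ac)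
    qed simp
    finally show ?thesis unfolding qt split by (simp only: mult_ac)
  qed
qed

section \<open>The incidence bound\<close>

lemma point_ball_card_bound:
  "\<exists>N::nat. \<forall>\<delta>>0. \<forall>(x::'a::euclidean_space) S.
     S \<subseteq> cball x \<delta> \<longrightarrow> Met_TC.delta_separated \<delta> S \<longrightarrow> card S \<le> N"
proof -
  obtain N :: nat where N: "\<forall>\<delta> (z::'a) (S::'a set) f. 0 < \<delta> \<longrightarrow> f ` S \<subseteq> cball z (1 * \<delta>) \<longrightarrow>
    (\<forall>u\<in>S. \<forall>v\<in>S. u \<noteq> v \<longrightarrow> \<delta> \<le> dist (f u) (f v)) \<longrightarrow> finite S \<and> card S \<le> N"
    using separated_map_card_bound[where 'a='a and 'b='a, of 1] by (rule exE)
  have "card S \<le> N" if "0 < \<delta>" "S \<subseteq> cball x \<delta>" "Met_TC.delta_separated \<delta> S" for \<delta> and x :: 'a and S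
    using N[THEN spec, of \<delta>, THEN spec, of x, THEN spec, of S, THEN spec, of "\<lambda>x. x"] that
    by (simp add: Met_TC.delta_separated_def)
  then show ?thesis by blast
qed

lemma point_separated_finite:
  fixes P :: "'a::euclidean_space set"
  assumes "P \<subseteq> cball 0 1" "0 < \<delta>" "Met_TC.delta_separated \<delta> P"
  shows "finite P"
proof -
  obtain N :: nat where N: "\<forall>\<eta> (z::'a) (S::'a set) f. 0 < \<eta> \<longrightarrow> f ` S \<subseteq> cball z ((1 / \<delta>) * \<eta>) \<longrightarrow>
    (\<forall>u\<in>S. \<forall>v\<in>S. u \<noteq> v \<longrightarrow> \<eta> \<le> dist (f u) (f v)) \<longrightarrow> finite S \<and> card S \<le> N"
    using separated_map_card_bound[where 'a='a and 'b='a, of "1 / \<delta>"] by (rule exE)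
  show ?thesis
    using N[THEN spec, of \<delta>, THEN spec, of 0, THEN spec, of P, THEN spec, of "\<lambda>x. x"] assms
    by (simp add: Met_TC.delta_separated_def)
qed

text \<open>Unit normals and feet each differ by at most 2, which gives \<open>2 * 2 + 2\<close>;
  the value 8 is a power of two above this.\<close>

lemma dist_hyp_le_8:
  assumes "V \<in> hyperplanes" "V \<inter> cball 0 1 \<noteq> {}" "W \<in> hyperplanes" "W \<inter> cball 0 1 \<noteq> {}"
  shows "dist_hyp V W \<le> 8"
proof -
  obtain n m where nm: "unit_normal V n" "unit_normal W m" using unit_normal_exists assms by blast
  then have u: "norm n = 1" "norm m = 1" by (auto simp: unit_normal_def)
  have "norm (n - m) \<le> 2" using norm_triangle_ineq4[of n m] u by simp
  moreover have "norm (foot V - foot W) \<le> 2"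
    using norm_triangle_ineq4[of "foot V" "foot W"] foot_norm_le_1 assms by (smt (verit))
  ultimately show ?thesis using dist_hyp_normals[OF nm] onorm_normals_le[OF u] by linarith
qed

text \<open>Supplies the combinatorial bound with the geometric counts. All packing and covering
  constants are fixed before \<open>\<delta>\<close>, \<open>P\<close> and \<open>H\<close>, which
  makes \<open>K\<close> uniform in them.\<close>

lemma incidence_bound:
  fixes C s t :: real
  assumes D: "2 \<le> DIM('a::euclidean_space)" and C: "0 \<le> C" and t: "0 \<le> t"
    and CP: "0 < C\<^sub>P" and CH: "0 < C\<^sub>H" and \<epsilon>: "0 < \<epsilon>"
  shows "\<exists>K>0. \<forall>\<delta> (P :: 'a set) (H :: 'a set set).
      0 < \<delta> \<longrightarrow> \<delta> < 1 \<longrightarrow> P \<subseteq> cball 0 1 \<longrightarrow> Met_TC.delta_separated \<delta> P \<longrightarrow>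
      Met_TC.delta_set \<delta> s C\<^sub>P P \<longrightarrow> H \<subseteq> hyperplanes \<longrightarrow> (\<forall>\<pi>\<in>H. \<pi> \<inter> cball 0 1 \<noteq> {}) \<longrightarrow>
      Hyp.delta_separated \<delta> H \<longrightarrow> Hyp.delta_set \<delta> t C\<^sub>H H \<longrightarrow>
      real (incidences (C * \<delta>) P H) \<le> K * real (card P) * real (card H)
        * \<delta> powr (incidence_exponent t * (s - real DIM('a) + 2) - \<epsilon>)"
proof -
  obtain N\<^sub>P :: nat where NP: "\<forall>\<delta>>0. \<forall>(x::'a) S.
      S \<subseteq> cball x \<delta> \<longrightarrow> Met_TC.delta_separated \<delta> S \<longrightarrow> card S \<le> N\<^sub>P"
    using point_ball_card_bound by (rule exE)
  obtain N\<^sub>H :: nat where NH: "\<forall>\<delta>>0. \<forall>V \<in> hyperplanes. \<forall>S :: 'a set set.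
      S \<subseteq> Hyp.mcball V \<delta> \<longrightarrow> Hyp.delta_separated \<delta> S \<longrightarrow> card S \<le> N\<^sub>H"
    using hyperplane_ball_card_bound by (rule exE)
  obtain K1 where K1: "K1 > 0" "\<forall>\<delta> M V (S::'a set). 0 < \<delta> \<longrightarrow> \<delta> < 1 \<longrightarrow> 0 \<le> M \<longrightarrow> V \<in> hyperplanes \<longrightarrow>
    finite S \<longrightarrow> S \<subseteq> cball 0 1 \<inter> neighborhood V (C * \<delta>) \<longrightarrow>
    (\<forall>U x. U \<subseteq> S \<longrightarrow> U \<subseteq> cball x \<delta> \<longrightarrow> real (card U) \<le> M) \<longrightarrow>
    real (card S) \<le> K1 * M / \<delta> ^ (DIM('a) - 1)"
    using card_neighborhood_hyperplane[OF C, where 'a='a] by (elim exE conjE)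
  obtain K2 where K2: "K2 > 0" "\<forall>\<delta> M V W (S::'a set). 0 < \<delta> \<longrightarrow> \<delta> < 1 \<longrightarrow> 0 \<le> M \<longrightarrow>
    V \<in> hyperplanes \<longrightarrow> W \<in> hyperplanes \<longrightarrow> W \<inter> cball 0 1 \<noteq> {} \<longrightarrow> 0 < dist_hyp V W \<longrightarrow>
    finite S \<longrightarrow> S \<subseteq> cball 0 1 \<inter> (neighborhood V (C * \<delta>) \<inter> neighborhood W (C * \<delta>)) \<longrightarrow>
    (\<forall>U x. U \<subseteq> S \<longrightarrow> U \<subseteq> cball x \<delta> \<longrightarrow> real (card U) \<le> M) \<longrightarrow>
    real (card S) \<le> K2 * M / (\<delta> ^ (DIM('a) - 2) * dist_hyp V W)"
    using card_neighborhood_two_hyperplanes[OF C D] by (elim exE conjE)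
  define a where "a = (K1 + K2) * (real N\<^sub>P * C\<^sub>P)"
  define B where "B = 1 + real N\<^sub>H * C\<^sub>H"
  \<comment> \<open>For \<open>u \<le> 1\<close> the bound \<open>u powr t\<close> implies the one
    with \<open>t'\<close>, and \<open>t' / (1 + t')\<close> equals 1/2 at \<open>t' = 1\<close>, so
    both cases of \<open>incidence_exponent\<close> are covered.\<close>
  define t' where "t' = min t 1"
  define \<sigma> where "\<sigma> = s - real DIM('a) + 2"
  have a: "0 \<le> a" using K1(1) K2(1) CP by (simp add: a_def)
  have B: "1 \<le> B" using CH by (simp add: B_def)
  have t': "0 \<le> t'" "t' \<le> 1" "t' \<le> t" using t by (auto simp: t'_def)
  have f: "incidence_exponent t = t' / (1 + t')" by (simp add: incidence_exponent_def t'_def)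
  let ?K = "a + B + 2 * a * B * (4 + 2 / \<epsilon>) + 1"
  show ?thesis
  proof (intro exI[of _ ?K] conjI allI impI)
    show "0 < ?K" using a B \<epsilon> by (intro add_nonneg_pos add_nonneg_nonneg) auto
    fix \<delta> :: real and P :: "'a set" and H :: "'a set set"
    assume \<delta>: "0 < \<delta>" "\<delta> < 1" and P: "P \<subseteq> cball 0 1" "Met_TC.delta_separated \<delta> P" "Met_TC.delta_set \<delta> s C\<^sub>P P"
      and H: "H \<subseteq> hyperplanes" "\<forall>\<pi>\<in>H. \<pi> \<inter> cball 0 1 \<noteq> {}" "Hyp.delta_separated \<delta> H" "Hyp.delta_set \<delta> t C\<^sub>H H"
    have fP: "finite P" using P(1) \<delta>(1) P(2) by (rule point_separated_finite)
    have fH: "finite H" using H(1,2) \<delta>(1) H(3) by (rule hyperplane_separated_finite)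
    \<comment> \<open>Non-concentration at the smallest admissible radius \<open>\<delta>\<close>
      bounds the points of \<open>P\<close> in any ball of that radius.\<close>
    define M where "M = real N\<^sub>P * C\<^sub>P * \<delta> powr s * real (card P)"
    have M0: "0 \<le> M" using CP by (simp add: M_def)
    have M: "real (card U) \<le> M" if "U \<subseteq> P" "U \<subseteq> cball x \<delta>" for U x
    proof -
      have "card U \<le> card (P \<inter> Met_TC.mcball x \<delta>)" using that fP by (intro card_mono) auto
      also have "real \<dots> \<le> M" unfolding M_def
      proof (rule Met_TC.delta_set_card_le[OF fP P(2,3)])
        show "card S \<le> N\<^sub>P" if "y \<in> UNIV" "S \<subseteq> Met_TC.mcball y \<delta>" "Met_TC.delta_separated \<delta> S" for y and S :: "'a set"
          using NP that \<delta>(1) unfolding mcball_eq_cball by blast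
      qed (use \<delta> in auto)
      finally show ?thesis by simp
    qed
    let ?A = "\<lambda>\<pi>. P \<inter> neighborhood \<pi> (C * \<delta>)"
    have pow: "\<delta> powr s / \<delta> ^ (DIM('a) - 1) = \<delta> powr (\<sigma> - 1)" "\<delta> powr s / \<delta> ^ (DIM('a) - 2) = \<delta> powr \<sigma>"
      using \<delta>(1) D by (simp_all add: \<sigma>_def algebra_simps flip: powr_realpow powr_diff)
    have "real (\<Sum>\<pi>\<in>H. card (?A \<pi>)) \<le> ?K * (real (card P) * real (card H)) * \<delta> powr (t' / (1 + t') * \<sigma> - \<epsilon>)"
    proof (rule incidence_bound_of_counts[OF fP fH _ \<delta> t'(1,2) a _ \<epsilon>, where \<rho> = dist_hyp])
      show "?A \<pi> \<subseteq> P" for \<pi> by blast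
      show "0 \<le> B" using B by simp
      show "real (card (?A \<pi>)) \<le> a * real (card P) * \<delta> powr (\<sigma> - 1)" if "\<pi> \<in> H" for \<pi>
      proof -
        have "real (card (?A \<pi>)) \<le> K1 * M / \<delta> ^ (DIM('a) - 1)"
        proof (rule K1(2)[rule_format, OF \<delta> M0])
          show "\<pi> \<in> hyperplanes" using that H(1) by blast
          show "finite (?A \<pi>)" using fP by simp
          show "?A \<pi> \<subseteq> cball 0 1 \<inter> neighborhood \<pi> (C * \<delta>)" using P(1) by blast
          show "real (card U) \<le> M" if "U \<subseteq> ?A \<pi>" "U \<subseteq> cball x \<delta>" for U x
            using that by (intro M[of U x]) auto
        qed
        also have "\<dots> = K1 * (real N\<^sub>P * C\<^sub>P) * real (card P) * \<delta> powr (\<sigma> - 1)"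
          unfolding M_def pow(1)[symmetric] by simp
        also have "\<dots> \<le> a * real (card P) * \<delta> powr (\<sigma> - 1)"
          unfolding a_def using K2(1) CP by (intro mult_right_mono) auto
        finally show ?thesis .
      qed
      show "real (card (?A \<pi> \<inter> ?A \<pi>')) \<le> a * real (card P) * \<delta> powr \<sigma> / dist_hyp \<pi> \<pi>'"
        if pp: "\<pi> \<in> H" "\<pi>' \<in> H" "0 < dist_hyp \<pi> \<pi>'" for \<pi> \<pi>'
      proof -
        have "real (card (?A \<pi> \<inter> ?A \<pi>')) \<le> K2 * M / (\<delta> ^ (DIM('a) - 2) * dist_hyp \<pi> \<pi>')"
        proof (rule K2(2)[rule_format, OF \<delta> M0 _ _ _ pp(3)])
          show "\<pi> \<in> hyperplanes" "\<pi>' \<in> hyperplanes" "\<pi>' \<inter> cball 0 1 \<noteq> {}" using pp H by blast+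
          show "finite (?A \<pi> \<inter> ?A \<pi>')" using fP by simp
          show "?A \<pi> \<inter> ?A \<pi>' \<subseteq> cball 0 1 \<inter> (neighborhood \<pi> (C * \<delta>) \<inter> neighborhood \<pi>' (C * \<delta>))"
            using P(1) by blast
          show "real (card U) \<le> M" if "U \<subseteq> ?A \<pi> \<inter> ?A \<pi>'" "U \<subseteq> cball x \<delta>" for U x
            using that by (intro M[of U x]) auto
        qed
        also have "\<dots> = K2 * (real N\<^sub>P * C\<^sub>P) * real (card P) * \<delta> powr \<sigma> / dist_hyp \<pi> \<pi>'"
          unfolding M_def pow(2)[symmetric] by simp
        also have "\<dots> \<le> a * real (card P) * \<delta> powr \<sigma> / dist_hyp \<pi> \<pi>'"
          unfolding a_def using K1(1) CP pp(3) by (intro divide_right_mono mult_right_mono) auto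
        finally show ?thesis .
      qed
      show "real (card {\<pi>' \<in> H. dist_hyp \<pi> \<pi>' \<le> u}) \<le> B * u powr t' * real (card H)"
        if pu: "\<pi> \<in> H" "\<delta> \<le> u" for \<pi> u
      proof (cases "u \<le> 1")
        case True
        have "{\<pi>' \<in> H. dist_hyp \<pi> \<pi>' \<le> u} = H \<inter> Hyp.mcball \<pi> u"
          using pu H(1) by auto
        then have "real (card {\<pi>' \<in> H. dist_hyp \<pi> \<pi>' \<le> u}) = real (card (H \<inter> Hyp.mcball \<pi> u))" by simp
        also have "\<dots> \<le> real N\<^sub>H * C\<^sub>H * u powr t * real (card H)"
        proof (rule Hyp.delta_set_card_le[OF fH H(3,4)])
          show "card S \<le> N\<^sub>H" if "V \<in> hyperplanes" "S \<subseteq> Hyp.mcball V \<delta>" "Hyp.delta_separated \<delta> S" for V and S :: "'a set set"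
            using NH that \<delta>(1) by blast
        qed (use pu True H(1) in auto)
        also have "\<dots> \<le> B * u powr t' * real (card H)"
          using True pu \<delta> t' CH by (intro mult_right_mono mult_mono powr_mono') (auto simp: B_def)
        finally show ?thesis .
      next
        case False
        \<comment> \<open>Radii above 1 are outside the non-concentration condition; the summand 1
          in \<open>B\<close> makes the trivial bound \<open>card H\<close> sufficient
          there.\<close>
        have "1 * 1 \<le> B * u powr t'" using False B t' by (intro mult_mono ge_one_powr_ge_zero) auto
        then have "1 * real (card H) \<le> B * u powr t' * real (card H)" by (intro mult_right_mono) auto
        moreover have "card {\<pi>' \<in> H. dist_hyp \<pi> \<pi>' \<le> u} \<le> card H" using fH by (intro card_mono) auto
        ultimately show ?thesis by simp
      qed
      show "dist_hyp \<pi> \<pi>' \<le> 8" if "\<pi> \<in> H" "\<pi>' \<in> H" for \<pi> \<pi>'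
        using that H by (intro dist_hyp_le_8) auto
    qed
    then show "real (incidences (C * \<delta>) P H) \<le> ?K * real (card P) * real (card H)
        * \<delta> powr (incidence_exponent t * (s - real DIM('a) + 2) - \<epsilon>)"
      unfolding incidences_eq_sum[OF fP fH] f \<sigma>_def by (simp only: mult.assoc)
  qed
qed

theorem theorem1p5:
  fixes C s t :: real
  assumes "CARD('n::finite) \<ge> 3"
    and "C > 0"
    and "0 \<le> s" "s \<le> real CARD('n)"
    and "0 \<le> t" "t \<le> real CARD('n)"
    and "s - real CARD('n) + 2 > 0"
  shows "\<exists>\<delta>\<^sub>0>0. \<forall>C\<^sub>P>0. \<forall>C\<^sub>H>0. \<forall>\<epsilon>>0. \<exists>K>0.
    \<forall>\<delta> (P :: (real ^ 'n) set) (H :: (real ^ 'n) set set).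
      0 < \<delta> \<longrightarrow> \<delta> < \<delta>\<^sub>0 \<longrightarrow>
      P \<subseteq> cball 0 1 \<longrightarrow>
      Metric_space.delta_separated UNIV dist \<delta> P \<longrightarrow>
      Metric_space.delta_set UNIV dist \<delta> s C\<^sub>P P \<longrightarrow>
      H \<subseteq> hyperplanes \<longrightarrow>
      (\<forall>\<pi>\<in>H. \<pi> \<inter> cball 0 1 \<noteq> {}) \<longrightarrow>
      Metric_space.delta_separated hyperplanes dist_hyp \<delta> H \<longrightarrow>
      Metric_space.delta_set hyperplanes dist_hyp \<delta> t C\<^sub>H H \<longrightarrow>
      real (incidences (C * \<delta>) P H)
        \<le> K * real (card P) * real (card H)
            * \<delta> powr (incidence_exponent t * (s - real CARD('n) + 2) - \<epsilon>)"
proof (rule exI[of _ 1], rule conjI[OF zero_less_one], intro allI impI)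
  \<comment> \<open>The threshold for \<open>\<delta>\<close> is 1, because
    \<open>incidence_bound\<close> is uniform over \<open>0 < \<delta> < 1\<close>.\<close>
  fix C\<^sub>P C\<^sub>H \<epsilon> :: real
  assume pos: "0 < C\<^sub>P" "0 < C\<^sub>H" "0 < \<epsilon>"
  have D: "DIM(real ^ 'n) = CARD('n)" by simp
  have "2 \<le> DIM(real ^ 'n)" "0 \<le> C" using assms(1,2) by simp_all
  from incidence_bound[OF this \<open>0 \<le> t\<close> pos, of s]
  show "\<exists>K>0. \<forall>\<delta> (P :: (real ^ 'n) set) (H :: (real ^ 'n) set set).
      0 < \<delta> \<longrightarrow> \<delta> < 1 \<longrightarrow>
      P \<subseteq> cball 0 1 \<longrightarrow>
      Metric_space.delta_separated UNIV dist \<delta> P \<longrightarrow>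
      Metric_space.delta_set UNIV dist \<delta> s C\<^sub>P P \<longrightarrow>
      H \<subseteq> hyperplanes \<longrightarrow>
      (\<forall>\<pi>\<in>H. \<pi> \<inter> cball 0 1 \<noteq> {}) \<longrightarrow>
      Metric_space.delta_separated hyperplanes dist_hyp \<delta> H \<longrightarrow>
      Metric_space.delta_set hyperplanes dist_hyp \<delta> t C\<^sub>H H \<longrightarrow>
      real (incidences (C * \<delta>) P H)
        \<le> K * real (card P) * real (card H)
            * \<delta> powr (incidence_exponent t * (s - real CARD('n) + 2) - \<epsilon>)"
    unfolding D .
qed

end
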